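(* Let $d\ge 1$. There are a constant $C_d>0$ and $k\in\mathbb{N}$ such that, with high probability, $G(n,C_d(\log n)^k/n)$ is $d$-rigid.
   Context: $G(n,p)$ is the Erdős–Rényi random graph on $n$ vertices with each edge present independently with probability $p$; "with high probability" means with probability tending to $1$ as $n\to\infty$. A $d$-dimensional framework $(G,p)$ places vertex $i$ at $p(i)\in\mathbb{R}^d$; it is generic if its coordinates are algebraically independent over $\mathbb{Q}$. It is rigid if there is a neighborhood $U$ of $p$ such that every $q\in U$ with $\|q(i)-q(j)\|=\|p(i)-p(j)\|$ for all edges $ij$ is related to $p$ by a Euclidean isometry. $G$ is $d$-rigid if every generic $d$-dimensional framework of $G$ is rigid. *)

theory Defs
  imports "HOL-Probability.Probability" "HOL-Library.Poly_Mapping"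
begin

text \<open>Multivariate polynomials over the rationals in variables indexed by \<open>'i\<close> are finitely
  supported maps from monomials (finitely supported exponent maps) to coefficients.\<close>

type_synonym 'i rat_mpoly = "('i \<Rightarrow>\<^sub>0 nat) \<Rightarrow>\<^sub>0 rat"

definition rat_mpoly_vars :: "'i rat_mpoly \<Rightarrow> 'i set" where
  "rat_mpoly_vars f = (\<Union>m \<in> Poly_Mapping.keys f. Poly_Mapping.keys m)"

definition rat_mpoly_eval :: "'i rat_mpoly \<Rightarrow> ('i \<Rightarrow> real) \<Rightarrow> real" where
  "rat_mpoly_eval f x =
     (\<Sum>m \<in> Poly_Mapping.keys f.
        of_rat (Poly_Mapping.lookup f m) *
          (\<Prod>i \<in> Poly_Mapping.keys m. x i ^ Poly_Mapping.lookup m i))"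

text \<open>Independence of the indexed family \<open>(x i)\<close>, \<open>i \<in> I\<close>, not merely of its set of values:
  repeated values are excluded.\<close>

definition algebraically_independent_over_rat :: "'i set \<Rightarrow> ('i \<Rightarrow> real) \<Rightarrow> bool" where
  "algebraically_independent_over_rat I x \<longleftrightarrow>
     (\<forall>f. rat_mpoly_vars f \<subseteq> I \<longrightarrow> rat_mpoly_eval f x = 0 \<longrightarrow> f = 0)"

text \<open>Only the values of a placement \<open>p :: 'v \<Rightarrow> real ^ 'd\<close> on the vertex set \<open>V\<close> matter;
  the dimension is \<open>CARD('d)\<close>.\<close>

definition generic_framework :: "'v set \<Rightarrow> ('v \<Rightarrow> real ^ 'd::finite) \<Rightarrow> bool" where
  "generic_framework V p \<longleftrightarrow>
     algebraically_independent_over_rat (V \<times> UNIV) (\<lambda>(v, a). p v $ a)"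

text \<open>The configuration space \<open>(\<real>\<^sup>d)\<^sup>V\<close> is the product topology on the functions that are
  \<open>undefined\<close> outside \<open>V\<close>. A distance-preserving self-map of \<open>\<real>\<^sup>d\<close> is automatically bijective,
  so \<open>T\<close> below is a Euclidean isometry.\<close>

definition rigid_framework :: "'v set \<Rightarrow> 'v set set \<Rightarrow> ('v \<Rightarrow> real ^ 'd::finite) \<Rightarrow> bool" where
  "rigid_framework V E p \<longleftrightarrow>
     (\<exists>U. openin (product_topology (\<lambda>_. euclidean) V) U \<and> restrict p V \<in> U \<and>
        (\<forall>q\<in>U. (\<forall>i j. {i, j} \<in> E \<longrightarrow> norm (q i - q j) = norm (p i - p j)) \<longrightarrow>
           (\<exists>T :: real ^ 'd \<Rightarrow> real ^ 'd.
              (\<forall>x y. dist (T x) (T y) = dist x y) \<and> (\<forall>i\<in>V. q i = T (p i)))))"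

definition rigid_graph :: "'d::finite itself \<Rightarrow> 'v set \<Rightarrow> 'v set set \<Rightarrow> bool" where
  "rigid_graph _ V E \<longleftrightarrow>
     (\<forall>p :: 'v \<Rightarrow> real ^ 'd. generic_framework V p \<longrightarrow> rigid_framework V E p)"

definition vertex_pairs :: "'v set \<Rightarrow> 'v set set" where
  "vertex_pairs V = {e. e \<subseteq> V \<and> card e = 2}"

text \<open>The edge set of \<open>G(n,p)\<close> on the vertex set \<open>{..<n}\<close>. The library's \<open>bernoulli_pmf\<close>
  truncates its parameter to \<open>[0,1]\<close>, so an edge probability exceeding \<open>1\<close> is read as \<open>1\<close>.\<close>

definition erdos_renyi :: "nat \<Rightarrow> real \<Rightarrow> nat set set pmf" where
  "erdos_renyi n p =
     map_pmf (\<lambda>f. {e \<in> vertex_pairs {..<n}. f e})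
       (Pi_pmf (vertex_pairs {..<n}) False (\<lambda>_. bernoulli_pmf p))"

end

theory Submission
  imports Defs "HOL-Real_Asymp.Real_Asymp"
begin

text \<open>Split the vertices into \<open>d\<close> classes. If every class induces a connected graph and every pair of
  classes spans a connected bipartite graph, then \<open>G\<close> is \<open>d\<close>-rigid (Krivelevich, Lew and Michaeli):
  place the class \<open>i\<close> near the unit vector \<open>e i\<close>, along the line spanned by \<open>e i\<close>. In the limit an
  infinitesimal motion is constant on the classes, so it comes from a motion of a simplex and is
  trivial. Full rank at one placement gives full rank at generic ones, since the pivots of the
  elimination are rational polynomials in the coordinates. For \<open>p = C ln n / n\<close> and classes of
  nearly equal size a union bound over cuts shows that the required graphs are connected with high
  probability, so \<open>k = 1\<close> suffices.

  To pass from infinitesimal to local rigidity, rotate an equivalent framework about a pinned vertex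
  so that it is as close to \<open>p\<close> as possible. The displacement \<open>x\<close> is then orthogonal to all
  infinitesimal rotations of \<open>p\<close>, and the edge lengths force \<open>2 (p u - p v) \<bullet> (x u - x v) =
  - (norm (x u - x v))\<^sup>2\<close>, a linear quantity bounded by a quadratic one; so a small \<open>x\<close> vanishes.\<close>

section \<open>Polynomial functions and elimination\<close>

definition rat_poly_fun :: "'i set \<Rightarrow> (('i \<Rightarrow> real) \<Rightarrow> real) \<Rightarrow> bool" where
  "rat_poly_fun I F \<longleftrightarrow> (\<exists>f. rat_mpoly_vars f \<subseteq> I \<and> (\<forall>x. rat_mpoly_eval f x = F x))"

definition mono_eval :: "('i \<Rightarrow>\<^sub>0 nat) \<Rightarrow> ('i \<Rightarrow> real) \<Rightarrow> real" where
  "mono_eval m x = (\<Prod>i\<in>Poly_Mapping.keys m. x i ^ Poly_Mapping.lookup m i)"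

text \<open>Exponents outside the keys are 0 and \<open>0 ^ 0 = 1\<close>, so enlarging the index
  set is harmless; it brings several monomials over a common one.\<close>

lemma mono_eval_superset:
  assumes "finite A" "Poly_Mapping.keys m \<subseteq> A"
  shows "mono_eval m x = (\<Prod>i\<in>A. x i ^ Poly_Mapping.lookup m i)"
  unfolding mono_eval_def
  by (rule prod.mono_neutral_left) (use assms in \<open>auto simp: in_keys_iff\<close>)

lemma mono_eval_add: "mono_eval (m + m') x = mono_eval m x * mono_eval m' x"
proof -
  define A where "A = Poly_Mapping.keys m \<union> Poly_Mapping.keys m'"
  have "finite A" "Poly_Mapping.keys (m + m') \<subseteq> A"
    unfolding A_def by (simp_all add: keys_add)
  then show ?thesis
    by (subst (1 2 3) mono_eval_superset[of A])
      (auto simp: A_def lookup_add power_add prod.distrib)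
qed

lemma rat_mpoly_eval_superset:
  assumes "finite A" "Poly_Mapping.keys f \<subseteq> A"
  shows "rat_mpoly_eval f x = (\<Sum>m\<in>A. of_rat (Poly_Mapping.lookup f m) * mono_eval m x)"
  unfolding rat_mpoly_eval_def mono_eval_def
  by (rule sum.mono_neutral_left) (use assms in \<open>auto simp: in_keys_iff\<close>)

lemma rat_mpoly_eval_add: "rat_mpoly_eval (f + g) x = rat_mpoly_eval f x + rat_mpoly_eval g x"
proof -
  define A where "A = Poly_Mapping.keys f \<union> Poly_Mapping.keys g"
  have "finite A" "Poly_Mapping.keys (f + g) \<subseteq> A"
    unfolding A_def by (simp_all add: keys_add)
  then show ?thesis
    by (subst (1 2 3) rat_mpoly_eval_superset[of A])
      (auto simp: A_def lookup_add of_rat_add sum.distrib algebra_simps)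
qed

lemma rat_poly_fun_single:
  assumes "Poly_Mapping.keys m \<subseteq> I"
  shows "rat_poly_fun I (\<lambda>x. of_rat c * mono_eval m x)"
  unfolding rat_poly_fun_def
proof (intro exI conjI allI)
  show "rat_mpoly_vars (Poly_Mapping.single m c) \<subseteq> I"
    using assms by (auto simp: rat_mpoly_vars_def)
  show "rat_mpoly_eval (Poly_Mapping.single m c) x = of_rat c * mono_eval m x" for x
    by (subst rat_mpoly_eval_superset[of "{m}"]) auto
qed

lemma rat_poly_fun_add:
  assumes "rat_poly_fun I F" "rat_poly_fun I G"
  shows "rat_poly_fun I (\<lambda>x. F x + G x)"
proof -
  from assms obtain f g where fg: "rat_mpoly_vars f \<subseteq> I" "rat_mpoly_vars g \<subseteq> I"
    "\<And>x. rat_mpoly_eval f x = F x" "\<And>x. rat_mpoly_eval g x = G x"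
    unfolding rat_poly_fun_def by blast
  have "rat_mpoly_vars (f + g) \<subseteq> I"
    using fg(1,2) keys_add[of f g] unfolding rat_mpoly_vars_def by blast
  with fg show ?thesis
    unfolding rat_poly_fun_def by (intro exI[of _ "f + g"]) (auto simp: rat_mpoly_eval_add)
qed

lemma rat_poly_fun_const: "rat_poly_fun I (\<lambda>_. of_rat c)"
  using rat_poly_fun_single[of 0 I c] by (simp add: mono_eval_def)

lemma rat_poly_fun_sum:
  assumes "\<And>a. a \<in> A \<Longrightarrow> rat_poly_fun I (F a)"
  shows "rat_poly_fun I (\<lambda>x. \<Sum>a\<in>A. F a x)"
  using assms
proof (induction A rule: infinite_finite_induct)
  case (insert a A)
  then show ?case by (simp add: rat_poly_fun_add)
qed (use rat_poly_fun_const[of I 0] in auto)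

lemma rat_poly_fun_mult:
  assumes "rat_poly_fun I F" "rat_poly_fun I G"
  shows "rat_poly_fun I (\<lambda>x. F x * G x)"
proof -
  from assms obtain f g where fg: "rat_mpoly_vars f \<subseteq> I" "rat_mpoly_vars g \<subseteq> I"
    "\<And>x. rat_mpoly_eval f x = F x" "\<And>x. rat_mpoly_eval g x = G x"
    unfolding rat_poly_fun_def by blast
  have "F x * G x = (\<Sum>m\<in>Poly_Mapping.keys f. \<Sum>m'\<in>Poly_Mapping.keys g.
      of_rat (Poly_Mapping.lookup f m * Poly_Mapping.lookup g m') * mono_eval (m + m') x)" for x
    unfolding fg(3,4)[symmetric] rat_mpoly_eval_def sum_product
    by (simp add: mono_eval_def[symmetric] mono_eval_add of_rat_mult mult_ac)
  moreover have "Poly_Mapping.keys (m + m') \<subseteq> I"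
    if "m \<in> Poly_Mapping.keys f" "m' \<in> Poly_Mapping.keys g" for m m'
    using that fg(1,2) keys_add[of m m'] unfolding rat_mpoly_vars_def by blast
  ultimately show ?thesis
    by (simp only:) (intro rat_poly_fun_sum rat_poly_fun_single)
qed

lemma rat_poly_fun_var: "i \<in> I \<Longrightarrow> rat_poly_fun I (\<lambda>x. x i)"
  using rat_poly_fun_single[of "Poly_Mapping.single i 1" I 1] by (simp add: mono_eval_def)

lemma rat_poly_fun_diff:
  assumes "rat_poly_fun I F" "rat_poly_fun I G"
  shows "rat_poly_fun I (\<lambda>x. F x - G x)"
  using rat_poly_fun_add[OF assms(1) rat_poly_fun_mult[OF rat_poly_fun_const[of I "-1"] assms(2)]]
  by (simp add: of_rat_minus)

text \<open>Vanishing at an independent point forces the polynomial itself to be zero, hence zero at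
  every \<open>y\<close>. One good placement thus certifies all generic ones.\<close>

lemma rat_poly_fun_nonzero_at_independent:
  assumes "algebraically_independent_over_rat I x" "rat_poly_fun I F" "F y \<noteq> 0"
  shows "F x \<noteq> 0"
proof
  assume "F x = 0"
  from assms(2) obtain f where f: "rat_mpoly_vars f \<subseteq> I" "\<And>x. rat_mpoly_eval f x = F x"
    unfolding rat_poly_fun_def by blast
  with assms(1) \<open>F x = 0\<close> have "f = 0"
    unfolding algebraically_independent_over_rat_def by metis
  then have "F y = 0" using f(2)[of y] by (simp add: rat_mpoly_eval_def)
  with assms(3) show False by contradiction
qed

section \<open>Stability of injective linear systems\<close>

text \<open>Injectivity of a linear system in quantitative form: \<open>K\<close> does not depend on
  \<open>x\<close>, which later lets a linear quantity be played off against a quadratic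
  one.\<close>

definition rows_control_coords :: "'j set \<Rightarrow> 'r set \<Rightarrow> ('r \<Rightarrow> 'j \<Rightarrow> real) \<Rightarrow> bool" where
  "rows_control_coords J R r \<longleftrightarrow>
     (\<exists>K\<ge>0. \<forall>x. \<forall>j\<in>J. \<bar>x j\<bar> \<le> K * (\<Sum>\<rho>\<in>R. \<bar>\<Sum>j\<in>J. r \<rho> j * x j\<bar>))"

text \<open>Fraction-free Gaussian elimination: \<open>D\<close> is the product of the pivots chosen at \<open>p0\<close>.\<close>

lemma injective_system_stability:
  fixes r :: "'r \<Rightarrow> 'j \<Rightarrow> 'p \<Rightarrow> real" and A :: "('p \<Rightarrow> real) set"
  assumes "finite J" "finite R"
    and one: "(\<lambda>_. 1) \<in> A"
    and mult: "\<And>F G. F \<in> A \<Longrightarrow> G \<in> A \<Longrightarrow> (\<lambda>p. F p * G p) \<in> A"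
    and diff: "\<And>F G. F \<in> A \<Longrightarrow> G \<in> A \<Longrightarrow> (\<lambda>p. F p - G p) \<in> A"
    and "\<And>\<rho> j. \<rho> \<in> R \<Longrightarrow> j \<in> J \<Longrightarrow> r \<rho> j \<in> A"
    and "\<And>x. (\<And>\<rho>. \<rho> \<in> R \<Longrightarrow> (\<Sum>j\<in>J. r \<rho> j p0 * x j) = 0) \<Longrightarrow> \<forall>j\<in>J. x j = 0"
  shows "\<exists>D\<in>A. D p0 \<noteq> 0 \<and> (\<forall>p. D p \<noteq> 0 \<longrightarrow> rows_control_coords J R (\<lambda>\<rho> j. r \<rho> j p))"
  using \<open>finite J\<close> assms(6,7)
proof (induction J arbitrary: r rule: finite_induct)
  case empty
  show ?case using one by (intro bexI[of _ "\<lambda>_. 1"]) (auto simp: rows_control_coords_def)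
next
  case (insert b J)
  \<comment> \<open>The unit vector at \<open>b\<close> is nonzero, so injectivity at
    \<open>p0\<close> yields a row that can serve as pivot.\<close>
  have ex: "\<exists>\<rho>0\<in>R. r \<rho>0 b p0 \<noteq> 0"
  proof (rule ccontr)
    assume "\<not> ?thesis"
    then have "(\<Sum>j\<in>insert b J. r \<rho> j p0 * of_bool (j = b)) = 0" if "\<rho> \<in> R" for \<rho>
      using that by (intro sum.neutral) auto
    from insert.prems(2)[OF this] show False by simp
  qed
  then obtain \<rho>0 where \<rho>0: "\<rho>0 \<in> R" "r \<rho>0 b p0 \<noteq> 0" by blast
  \<comment> \<open>Cross-multiplying with the pivot row eliminates \<open>b\<close> without
    division, so the entries stay in \<open>A\<close>: continuous functions in one application,
    rational polynomial functions in the other.\<close>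
  define r' where "r' \<rho> j p = r \<rho>0 b p * r \<rho> j p - r \<rho> b p * r \<rho>0 j p" for \<rho> j p
  define L where "L \<rho> p x = (\<Sum>j\<in>insert b J. r \<rho> j p * x j)" for \<rho> p and x :: "'j \<Rightarrow> real"
  have L': "(\<Sum>j\<in>J. r' \<rho> j p * x j) = r \<rho>0 b p * L \<rho> p x - r \<rho> b p * L \<rho>0 p x" for \<rho> p x
    using insert.hyps
    by (simp add: r'_def L_def algebra_simps sum_subtractf sum_distrib_left sum.distrib)
  have "\<exists>D\<in>A. D p0 \<noteq> 0 \<and> (\<forall>p. D p \<noteq> 0 \<longrightarrow> rows_control_coords J R (\<lambda>\<rho> j. r' \<rho> j p))"
  proof (rule insert.IH)
    fix \<rho> j assume "\<rho> \<in> R" "j \<in> J"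
    then show "r' \<rho> j \<in> A"
      unfolding r'_def using insert.prems(1) \<rho>0 by (intro diff mult) auto
  next
    fix x assume *: "\<And>\<rho>. \<rho> \<in> R \<Longrightarrow> (\<Sum>j\<in>J. r' \<rho> j p0 * x j) = 0"
    \<comment> \<open>Back substitution: the value at \<open>b\<close> is chosen so that the pivot
      row vanishes.\<close>
    define y where "y = x(b := - (\<Sum>j\<in>J. r \<rho>0 j p0 * x j) / r \<rho>0 b p0)"
    have yx: "(\<Sum>j\<in>J. g j * y j) = (\<Sum>j\<in>J. g j * x j)" for g :: "'j \<Rightarrow> real"
      using insert.hyps by (intro sum.cong) (auto simp: y_def)
    have "L \<rho>0 p0 y = 0"
      unfolding L_def using insert.hyps \<rho>0 by (simp add: yx) (simp add: y_def)
    then have "L \<rho> p0 y = 0" if "\<rho> \<in> R" for \<rho>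
      using L'[of \<rho> p0 y] *[OF that] \<rho>0(2) by (simp add: yx)
    then have "\<forall>j\<in>insert b J. y j = 0"
      by (intro insert.prems(2)) (auto simp: L_def)
    then show "\<forall>j\<in>J. x j = 0"
      using insert.hyps by (auto simp: y_def split: if_splits)
  qed
  then obtain D where D: "D \<in> A" "D p0 \<noteq> 0" and DK: "\<And>p. D p \<noteq> 0 \<Longrightarrow> rows_control_coords J R (\<lambda>\<rho> j. r' \<rho> j p)"
    by blast
  show ?case
  proof (intro bexI conjI allI impI)
    show "(\<lambda>p. D p * r \<rho>0 b p) \<in> A" using mult D insert.prems(1) \<rho>0 by auto
    show "D p0 * r \<rho>0 b p0 \<noteq> 0" using D \<rho>0 by simp
    fix p assume "D p * r \<rho>0 b p \<noteq> 0"
    then have piv: "r \<rho>0 b p \<noteq> 0" and "D p \<noteq> 0" by auto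
    then obtain K where K: "K \<ge> 0" and
      Kx: "\<And>x j. j \<in> J \<Longrightarrow> \<bar>x j\<bar> \<le> K * (\<Sum>\<rho>\<in>R. \<bar>\<Sum>j\<in>J. r' \<rho> j p * x j\<bar>)"
      using DK unfolding rows_control_coords_def by blast
    \<comment> \<open>\<open>C\<close> bounds the reduced rows by the original ones;
      \<open>K2\<close> comes from solving the pivot row for \<open>x b\<close>.\<close>
    define C where "C = \<bar>r \<rho>0 b p\<bar> + (\<Sum>\<rho>\<in>R. \<bar>r \<rho> b p\<bar>)"
    have C: "C \<ge> 0" unfolding C_def by (simp add: sum_nonneg)
    define K2 where "K2 = (1 + (\<Sum>j\<in>J. \<bar>r \<rho>0 j p\<bar>) * (K * C)) / \<bar>r \<rho>0 b p\<bar>"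
    have K2: "K2 \<ge> 0" unfolding K2_def using K C by (simp add: sum_nonneg)
    define S where "S x = (\<Sum>\<rho>\<in>R. \<bar>L \<rho> p x\<bar>)" for x
    have S: "S x \<ge> 0" for x unfolding S_def by (simp add: sum_nonneg)
    have L0: "\<bar>L \<rho>0 p x\<bar> \<le> S x" for x
      unfolding S_def using \<rho>0(1) \<open>finite R\<close> by (intro member_le_sum) auto
    have bJ: "\<bar>x j\<bar> \<le> (K * C) * S x" if "j \<in> J" for x j
    proof -
      have "(\<Sum>\<rho>\<in>R. \<bar>\<Sum>j\<in>J. r' \<rho> j p * x j\<bar>)
          \<le> (\<Sum>\<rho>\<in>R. \<bar>r \<rho>0 b p\<bar> * \<bar>L \<rho> p x\<bar> + \<bar>r \<rho> b p\<bar> * \<bar>L \<rho>0 p x\<bar>)"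
        unfolding L' by (intro sum_mono order.trans[OF abs_triangle_ineq4]) (simp add: abs_mult)
      also have "\<dots> = \<bar>r \<rho>0 b p\<bar> * S x + (\<Sum>\<rho>\<in>R. \<bar>r \<rho> b p\<bar>) * \<bar>L \<rho>0 p x\<bar>"
        by (simp add: S_def sum.distrib sum_distrib_left sum_distrib_right)
      also have "\<dots> \<le> C * S x"
        unfolding C_def distrib_right
        by (intro add_mono order.refl mult_left_mono L0) (simp add: sum_nonneg)
      finally have "(\<Sum>\<rho>\<in>R. \<bar>\<Sum>j\<in>J. r' \<rho> j p * x j\<bar>) \<le> C * S x" .
      from mult_left_mono[OF this K] Kx[OF that, of x] show ?thesis by (simp add: mult.assoc)
    qed
    have bb: "\<bar>x b\<bar> \<le> K2 * S x" for x
    proof -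
      have "r \<rho>0 b p * x b = L \<rho>0 p x - (\<Sum>j\<in>J. r \<rho>0 j p * x j)"
        using insert.hyps by (simp add: L_def)
      then have "\<bar>r \<rho>0 b p\<bar> * \<bar>x b\<bar> = \<bar>L \<rho>0 p x - (\<Sum>j\<in>J. r \<rho>0 j p * x j)\<bar>"
        by (metis abs_mult)
      also have "\<dots> \<le> \<bar>L \<rho>0 p x\<bar> + (\<Sum>j\<in>J. \<bar>r \<rho>0 j p\<bar> * \<bar>x j\<bar>)"
        by (intro order.trans[OF abs_triangle_ineq4] add_left_mono order.trans[OF sum_abs])
          (simp add: abs_mult)
      also have "\<dots> \<le> S x + (\<Sum>j\<in>J. \<bar>r \<rho>0 j p\<bar> * ((K * C) * S x))"
        using bJ by (intro add_mono L0 sum_mono mult_left_mono) auto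
      also have "\<dots> = \<bar>r \<rho>0 b p\<bar> * (K2 * S x)"
        using piv by (simp add: K2_def distrib_right mult.assoc flip: sum_distrib_right)
      finally show ?thesis using piv by simp
    qed
    have "\<bar>x j\<bar> \<le> (K * C + K2) * S x" if "j \<in> insert b J" for x j
      using that bJ[of j x] bb[of x] S[of x] K C K2
      by (auto simp: distrib_right intro: add_increasing add_increasing2)
    then show "rows_control_coords (insert b J) R (\<lambda>\<rho> j. r \<rho> j p)"
      using K C K2 unfolding S_def L_def rows_control_coords_def by (intro exI[of _ "K * C + K2"]) auto
  qed
qed

section \<open>Rigid partitions\<close>

text \<open>For symmetric \<open>H\<close>, connectedness of the graph on \<open>W\<close> formed by
  the edges of \<open>E\<close> that satisfy \<open>H\<close>. The formulation by cuts suits both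
  constancy arguments and union bounds.\<close>

definition cut_connected :: "'v set \<Rightarrow> ('v \<Rightarrow> 'v \<Rightarrow> bool) \<Rightarrow> 'v set set \<Rightarrow> bool" where
  "cut_connected W H E \<longleftrightarrow>
     (\<forall>S. S \<subseteq> W \<and> S \<noteq> {} \<and> S \<noteq> W \<longrightarrow> (\<exists>u\<in>S. \<exists>v\<in>W - S. H u v \<and> {u, v} \<in> E))"

text \<open>Otherwise the level set of \<open>g\<close> through \<open>u\<close> is a proper cut,
  and the edge crossing it would join different values.\<close>

lemma cut_connected_constant:
  assumes "cut_connected W H E"
    and "\<And>u v. u \<in> W \<Longrightarrow> v \<in> W \<Longrightarrow> H u v \<Longrightarrow> {u, v} \<in> E \<Longrightarrow> g u = g v"
    and "u \<in> W" "v \<in> W"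
  shows "g u = g v"
proof (rule ccontr)
  assume "g u \<noteq> g v"
  define S where "S = {w\<in>W. g w = g u}"
  have "v \<notin> S" using \<open>g u \<noteq> g v\<close> by (simp add: S_def)
  then have "S \<subseteq> W" "S \<noteq> {}" "S \<noteq> W" using assms(3,4) by (auto simp: S_def)
  then obtain a b where "a \<in> S" "b \<in> W - S" "H a b" "{a, b} \<in> E"
    using assms(1) unfolding cut_connected_def by meson
  then show False using assms(2)[of a b] by (auto simp: S_def)
qed

text \<open>For \<open>i = j\<close> this says that the class \<open>i\<close> induces a connected graph, for \<open>i \<noteq> j\<close> that the
  bipartite graph between the classes \<open>i\<close> and \<open>j\<close> is connected.\<close>

definition rigid_partition :: "'v set \<Rightarrow> ('v \<Rightarrow> 'd) \<Rightarrow> 'v set set \<Rightarrow> bool" where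
  "rigid_partition V \<pi> E \<longleftrightarrow> \<pi> ` V = UNIV \<and>
     (\<forall>i j. cut_connected {v\<in>V. \<pi> v = i \<or> \<pi> v = j} (\<lambda>u v. \<pi> u = \<pi> v \<longleftrightarrow> i = j) E)"

text \<open>The rows of the rigidity matrix, completed by rows that pin the vertex \<open>v0\<close> and are orthogonal
  to the infinitesimal rotations about it.\<close>

datatype ('v, 'd) row = Edge 'v 'v | Pin 'd | Rot 'd 'd

text \<open>An \<open>Edge\<close> row is half the derivative of the squared edge length; a
  \<open>Rot\<close> row pairs a motion with the infinitesimal rotation about \<open>v0\<close> in
  the plane of the coordinates \<open>a\<close> and \<open>b\<close>.\<close>

fun row_coeff :: "'v \<Rightarrow> ('v \<times> 'd \<Rightarrow> real) \<Rightarrow> ('v, 'd) row \<Rightarrow> 'v \<times> 'd \<Rightarrow> real" where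
  "row_coeff v0 P (Edge u v) (w, c) = (P (u, c) - P (v, c)) * (of_bool (w = u) - of_bool (w = v))"
| "row_coeff v0 P (Pin a) (w, c) = of_bool (w = v0 \<and> c = a)"
| "row_coeff v0 P (Rot a b) (w, c) =
     (P (w, a) - P (v0, a)) * of_bool (c = b) - (P (w, b) - P (v0, b)) * of_bool (c = a)"

definition rows :: "'v set \<Rightarrow> 'v set set \<Rightarrow> ('v, 'd) row set" where
  "rows V E = {Edge u v | u v. u \<in> V \<and> v \<in> V \<and> {u, v} \<in> E} \<union> range Pin \<union> {Rot a b | a b. True}"

lemma finite_rows:
  assumes "finite V"
  shows "finite (rows V E :: ('v, 'd::finite) row set)"
proof (rule finite_subset)
  show "rows V E \<subseteq> (\<lambda>(u, v). Edge u v) ` (V \<times> V) \<union> range Pin \<union> range (\<lambda>(a, b). Rot a b)"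
    by (auto simp: rows_def)
qed (use assms in auto)

section \<open>Values of the rows on a motion\<close>

lemma sum_vertex_coords:
  "(\<Sum>j\<in>V \<times> (UNIV :: 'd::finite set). f j) = (\<Sum>w\<in>V. \<Sum>c\<in>UNIV. f (w, c))"
  by (simp add: sum.cartesian_product)

lemma sum_of_bool_diff:
  fixes g :: "'v \<Rightarrow> real"
  assumes "finite V" "u \<in> V" "v \<in> V"
  shows "(\<Sum>w\<in>V. (of_bool (w = u) - of_bool (w = v)) * g w) = g u - g v"
proof -
  have "(of_bool (w = u) - of_bool (w = v)) * g w
      = (if w = u then g w else 0) - (if w = v then g w else 0)" for w
    by simp
  then show ?thesis using assms by (simp add: sum_subtractf)
qed

lemma row_sum_Edge:
  fixes P :: "'v \<times> 'd::finite \<Rightarrow> real"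
  assumes "finite V" "u \<in> V" "v \<in> V"
  shows "(\<Sum>j\<in>V \<times> UNIV. row_coeff v0 P (Edge u v) j * x j)
    = (\<Sum>c\<in>UNIV. (P (u, c) - P (v, c)) * (x (u, c) - x (v, c)))"
proof -
  have "(\<Sum>j\<in>V \<times> UNIV. row_coeff v0 P (Edge u v) j * x j)
    = (\<Sum>c\<in>UNIV. \<Sum>w\<in>V. (P (u, c) - P (v, c)) * (of_bool (w = u) - of_bool (w = v)) * x (w, c))"
    by (simp only: sum_vertex_coords row_coeff.simps) (rule sum.swap)
  also have "\<dots> = (\<Sum>c\<in>UNIV. (P (u, c) - P (v, c)) * (x (u, c) - x (v, c)))"
    using assms
    by (intro sum.cong refl) (simp only: mult.assoc sum_of_bool_diff flip: sum_distrib_left)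
  finally show ?thesis .
qed

lemma row_sum_Pin:
  fixes P :: "'v \<times> 'd::finite \<Rightarrow> real"
  assumes "finite V" "v0 \<in> V"
  shows "(\<Sum>j\<in>V \<times> UNIV. row_coeff v0 P (Pin a) j * x j) = x (v0, a)"
proof -
  have "(\<Sum>j\<in>V \<times> UNIV. row_coeff v0 P (Pin a) j * x j)
      = (\<Sum>j\<in>V \<times> UNIV. if j = (v0, a) then x j else 0)"
    by (intro sum.cong) auto
  also have "\<dots> = x (v0, a)" using assms by (subst sum.delta) auto
  finally show ?thesis .
qed

lemma row_sum_Rot:
  fixes P :: "'v \<times> 'd::finite \<Rightarrow> real"
  shows "(\<Sum>j\<in>V \<times> UNIV. row_coeff v0 P (Rot a b) j * x j)
    = (\<Sum>w\<in>V. (P (w, a) - P (v0, a)) * x (w, b) - (P (w, b) - P (v0, b)) * x (w, a))"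
proof -
  have "(\<Sum>c\<in>UNIV. (A * of_bool (c = b) - B * of_bool (c = a)) * g c) = A * g b - B * g a"
    for A B and g :: "'d \<Rightarrow> real"
  proof -
    have "(A * of_bool (c = b) - B * of_bool (c = a)) * g c
        = (if c = b then A * g c else 0) - (if c = a then B * g c else 0)" for c
      by (simp add: algebra_simps)
    then show ?thesis by (simp add: sum_subtractf)
  qed
  then show ?thesis by (simp only: sum_vertex_coords row_coeff.simps)
qed

text \<open>The placement that collapses the class \<open>i\<close> to the unit vector \<open>e i\<close>. The edges inside that
  class are given the direction \<open>e i\<close>, the limit of their directions in the placements
  \<open>v \<mapsto> (1 + t * v) *\<^sub>R e (\<pi> v)\<close> as \<open>t \<rightarrow> 0\<close>.\<close>

lemma collapsed_framework_injective:
  fixes x :: "'v \<times> 'd::finite \<Rightarrow> real" and \<pi> :: "'v \<Rightarrow> 'd"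
  assumes part: "rigid_partition V \<pi> E" and "finite V" "v0 \<in> V"
    and same: "\<And>u v. u \<in> V \<Longrightarrow> v \<in> V \<Longrightarrow> {u, v} \<in> E \<Longrightarrow> \<pi> u = \<pi> v \<Longrightarrow> x (u, \<pi> u) = x (v, \<pi> u)"
    and cross: "\<And>u v. u \<in> V \<Longrightarrow> v \<in> V \<Longrightarrow> {u, v} \<in> E \<Longrightarrow> \<pi> u \<noteq> \<pi> v \<Longrightarrow>
      x (u, \<pi> u) - x (u, \<pi> v) = x (v, \<pi> u) - x (v, \<pi> v)"
    and pin: "\<And>a. x (v0, a) = 0"
    and rot: "\<And>a b. (\<Sum>w\<in>V. (of_bool (a = \<pi> w) - of_bool (a = \<pi> v0)) * x (w, b)
      - (of_bool (b = \<pi> w) - of_bool (b = \<pi> v0)) * x (w, a)) = 0"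
  shows "\<forall>j\<in>V \<times> UNIV. x j = 0"
proof -
  have surj: "\<pi> ` V = UNIV"
    and conn: "\<And>i j. cut_connected {v\<in>V. \<pi> v = i \<or> \<pi> v = j} (\<lambda>u v. \<pi> u = \<pi> v \<longleftrightarrow> i = j) E"
    using part unfolding rigid_partition_def by auto
  \<comment> \<open>Edges inside class \<open>i\<close> equalise coordinate \<open>i\<close> at
    their ends; edges between classes \<open>i\<close> and \<open>j\<close> equalise the difference
    of these two coordinates. Connectedness makes both constant.\<close>
  have c1: "x (u, i) = x (v, i)" if "u \<in> V" "v \<in> V" "\<pi> u = i" "\<pi> v = i" for u v i
  proof (rule cut_connected_constant[OF conn[of i i], where g = "\<lambda>v. x (v, i)"])
    fix a b assume "a \<in> {v\<in>V. \<pi> v = i \<or> \<pi> v = i}" "b \<in> {v\<in>V. \<pi> v = i \<or> \<pi> v = i}" "{a, b} \<in> E"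
    then show "x (a, i) = x (b, i)" using same[of a b] by simp
  qed (use that in auto)
  have c2: "x (u, i) - x (u, j) = x (v, i) - x (v, j)"
    if "u \<in> V" "v \<in> V" "\<pi> u = i \<or> \<pi> u = j" "\<pi> v = i \<or> \<pi> v = j" "i \<noteq> j" for u v i j
  proof (rule cut_connected_constant[OF conn[of i j], where g = "\<lambda>v. x (v, i) - x (v, j)"])
    fix a b assume "a \<in> {v\<in>V. \<pi> v = i \<or> \<pi> v = j}" "b \<in> {v\<in>V. \<pi> v = i \<or> \<pi> v = j}"
      "(\<pi> a = \<pi> b) = (i = j)" "{a, b} \<in> E"
    then show "x (a, i) - x (a, j) = x (b, i) - x (b, j)"
      using cross[of a b] \<open>i \<noteq> j\<close> by auto
  qed (use that in auto)
  define rep where "rep i = (SOME v. v \<in> V \<and> \<pi> v = i)" for i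
  have rep: "rep i \<in> V" "\<pi> (rep i) = i" for i
  proof -
    have "\<exists>v. v \<in> V \<and> \<pi> v = i" using surj by (metis UNIV_I imageE)
    from someI_ex[OF this] show "rep i \<in> V" "\<pi> (rep i) = i" by (auto simp: rep_def)
  qed
  \<comment> \<open>The motion turns out to be constant on classes, so it is a motion
    \<open>M\<close> of the vertices of a simplex.\<close>
  define M where "M i a = x (rep i, a)" for i a
  have xM: "x (v, a) = M (\<pi> v) a" if "v \<in> V" for v a
  proof -
    have "x (v, \<pi> v) = x (rep (\<pi> v), \<pi> v)" using that rep by (intro c1) auto
    moreover have "x (v, \<pi> v) - x (v, a) = x (rep (\<pi> v), \<pi> v) - x (rep (\<pi> v), a)" if "a \<noteq> \<pi> v"
      using \<open>v \<in> V\<close> that rep by (intro c2) auto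
    ultimately show ?thesis unfolding M_def by (cases "a = \<pi> v") auto
  qed
  have M0: "M (\<pi> v0) a = 0" for a using xM[OF \<open>v0 \<in> V\<close>] pin by metis
  \<comment> \<open>Removing the translation with coordinates \<open>M a a\<close> leaves a matrix;
    \<open>c2\<close> between representatives makes it skew, an infinitesimal rotation.\<close>
  define A where "A a i = M i a - M a a" for a i
  have skew: "A i a = - A a i" for a i
    using c2[OF rep(1) rep(1), of i a i a] rep by (cases "i = a") (auto simp: A_def M_def)
  \<comment> \<open>Position of \<open>w\<close> relative to the pinned vertex in the collapsed
    placement; \<open>xA\<close> says that the motion is \<open>A\<close> applied to it.\<close>
  define Z where "Z w a = (of_bool (a = \<pi> w) - of_bool (a = \<pi> v0) :: real)" for w a
  have xA: "x (w, a) = (\<Sum>b\<in>UNIV. A a b * Z w b)" if "w \<in> V" for w a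
  proof -
    have "(\<Sum>b\<in>UNIV. A a b * Z w b) = A a (\<pi> w) - A a (\<pi> v0)"
      using sum_of_bool_diff[of UNIV "\<pi> w" "\<pi> v0" "A a"] by (simp only: Z_def mult.commute) simp
    then show ?thesis using that by (simp add: A_def xM M0)
  qed
  \<comment> \<open>The hypothesis \<open>rot\<close> makes \<open>T\<close> symmetric, so its
    pairing with the skew \<open>A\<close> vanishes; that pairing is the squared norm of
    \<open>x\<close>.\<close>
  define T where "T a b = (\<Sum>w\<in>V. Z w b * x (w, a))" for a b
  have T: "T b a = T a b" for a b
    using rot[of a b] by (simp add: T_def Z_def sum_subtractf)
  have "(\<Sum>w\<in>V. \<Sum>a\<in>UNIV. (x (w, a))\<^sup>2) = (\<Sum>w\<in>V. \<Sum>a\<in>UNIV. \<Sum>b\<in>UNIV. A a b * (Z w b * x (w, a)))"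
    by (intro sum.cong refl) (simp add: power2_eq_square sum_distrib_right xA mult.assoc)
  also have "\<dots> = (\<Sum>a\<in>UNIV. \<Sum>w\<in>V. \<Sum>b\<in>UNIV. A a b * (Z w b * x (w, a)))"
    by (rule sum.swap)
  also have "\<dots> = (\<Sum>a\<in>UNIV. \<Sum>b\<in>UNIV. \<Sum>w\<in>V. A a b * (Z w b * x (w, a)))"
    by (intro sum.cong refl sum.swap)
  also have "\<dots> = (\<Sum>a\<in>UNIV. \<Sum>b\<in>UNIV. A a b * T a b)"
    by (simp add: T_def sum_distrib_left)
  finally have sq: "(\<Sum>w\<in>V. \<Sum>a\<in>UNIV. (x (w, a))\<^sup>2) = (\<Sum>a\<in>UNIV. \<Sum>b\<in>UNIV. A a b * T a b)" .
  have "(\<Sum>a\<in>UNIV. \<Sum>b\<in>UNIV. A a b * T a b) = (\<Sum>a\<in>UNIV. \<Sum>b\<in>UNIV. A b a * T b a)"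
    by (rule sum.swap)
  also have "\<dots> = (\<Sum>a\<in>UNIV. \<Sum>b\<in>UNIV. - (A a b * T a b))"
    by (intro sum.cong refl) (metis T skew mult_minus_left)
  finally have "(\<Sum>j\<in>V \<times> UNIV. (x j)\<^sup>2) = 0"
    using sq by (simp add: sum_vertex_coords sum_negf)
  then show ?thesis using \<open>finite V\<close> by (subst (asm) sum_nonneg_eq_0_iff) auto
qed

section \<open>From the collapsed limit to generic placements\<close>

text \<open>Injectivity at the limit \<open>t = 0\<close> persists for nearby \<open>t\<close> by
  stability with continuous coefficients. For \<open>t \<noteq> 0\<close> the rescaled rows are, up
  to nonzero factors, the rows of an actual placement.\<close>

lemma exists_injective_placement:
  fixes \<pi> :: "nat \<Rightarrow> 'd::finite"
  assumes part: "rigid_partition V \<pi> E" and "finite V" "v0 \<in> V"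
  shows "\<exists>P. \<forall>x. (\<forall>\<rho>\<in>rows V E. (\<Sum>j\<in>V \<times> UNIV. row_coeff v0 P \<rho> j * x j) = 0)
    \<longrightarrow> (\<forall>j\<in>V \<times> (UNIV :: 'd set). x j = 0)"
proof -
  \<comment> \<open>The number of a vertex serves as its offset, so distinct vertices of a class are
    distinct points when \<open>t\<close> is small and nonzero.\<close>
  define P :: "real \<Rightarrow> nat \<times> 'd \<Rightarrow> real"
    where "P t = (\<lambda>(w, c). (1 + t * real w) * of_bool (c = \<pi> w))" for t
  \<comment> \<open>At \<open>P t\<close> the edges inside a class have length of order \<open>t\<close>; their rows are rescaled.\<close>
  define r where "r \<rho> j t = (case \<rho> of
      Edge u v \<Rightarrow> if \<pi> u = \<pi> v
        then of_bool (snd j = \<pi> u) * (of_bool (fst j = u) - of_bool (fst j = v))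
        else row_coeff v0 (P t) \<rho> j
    | _ \<Rightarrow> row_coeff v0 (P t) \<rho> j)" for \<rho> j t
  have r_same: "(\<Sum>j\<in>V \<times> UNIV. r (Edge u v) j t * x j) = x (u, \<pi> u) - x (v, \<pi> u)"
    if "u \<in> V" "v \<in> V" "\<pi> u = \<pi> v" for u v t and x :: "nat \<times> 'd \<Rightarrow> real"
  proof -
    have "r (Edge u v) j t = of_bool (j = (u, \<pi> u)) - of_bool (j = (v, \<pi> u))" for j
      unfolding r_def row.case if_P[OF that(3)] by (cases j) auto
    then show ?thesis using that \<open>finite V\<close> by (simp only:) (rule sum_of_bool_diff, auto)
  qed
  define R where "R = (rows V E :: (nat, 'd) row set)"
  have "\<exists>D\<in>{f :: real \<Rightarrow> real. continuous_on UNIV f}. D 0 \<noteq> 0 \<and>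
    (\<forall>t. D t \<noteq> 0 \<longrightarrow> rows_control_coords (V \<times> UNIV) R (\<lambda>\<rho> j. r \<rho> j t))"
  proof (rule injective_system_stability)
    show "finite (V \<times> (UNIV :: 'd set))" "finite R"
      using \<open>finite V\<close> finite_rows by (auto simp: R_def)
    fix \<rho> and j :: "nat \<times> 'd"
    obtain w c where j: "j = (w, c)" by (cases j)
    have "continuous_on UNIV (\<lambda>t. P t i)" for i
      unfolding P_def by (cases i) (auto intro!: continuous_intros)
    then have row: "continuous_on UNIV (\<lambda>t. row_coeff v0 (P t) \<rho> j)"
      unfolding j by (cases \<rho>) (auto intro!: continuous_intros)
    show "r \<rho> j \<in> {f. continuous_on UNIV f}"
    proof (cases "\<exists>u v. \<rho> = Edge u v \<and> \<pi> u = \<pi> v")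
      case True
      then show ?thesis by (auto simp: r_def)
    next
      case False
      then have "r \<rho> j = (\<lambda>t. row_coeff v0 (P t) \<rho> j)"
        by (cases \<rho>) (auto simp: r_def)
      with row show ?thesis by simp
    qed
  next
    fix x :: "nat \<times> 'd \<Rightarrow> real"
    assume *: "\<And>\<rho>. \<rho> \<in> R \<Longrightarrow> (\<Sum>j\<in>V \<times> UNIV. r \<rho> j 0 * x j) = 0"
    show "\<forall>j\<in>V \<times> UNIV. x j = 0"
    proof (rule collapsed_framework_injective[OF part \<open>finite V\<close> \<open>v0 \<in> V\<close>])
      fix u v assume uv: "u \<in> V" "v \<in> V" "{u, v} \<in> E"
      then have "Edge u v \<in> R" by (auto simp: R_def rows_def)
      note row = *[OF this]
      show "x (u, \<pi> u) = x (v, \<pi> u)" if "\<pi> u = \<pi> v"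
        using row r_same[OF uv(1,2) that, of 0 x] by simp
      assume ne: "\<pi> u \<noteq> \<pi> v"
      have "(\<Sum>j\<in>V \<times> UNIV. r (Edge u v) j 0 * x j)
          = (\<Sum>j\<in>V \<times> UNIV. row_coeff v0 (P 0) (Edge u v) j * x j)"
        using ne by (simp add: r_def)
      also have "\<dots> = (\<Sum>c\<in>UNIV. (of_bool (c = \<pi> u) - of_bool (c = \<pi> v)) * (x (u, c) - x (v, c)))"
        by (simp only: row_sum_Edge[OF \<open>finite V\<close> uv(1,2)]) (simp add: P_def)
      also have "\<dots> = (x (u, \<pi> u) - x (v, \<pi> u)) - (x (u, \<pi> v) - x (v, \<pi> v))"
        by (rule sum_of_bool_diff) auto
      finally show "x (u, \<pi> u) - x (u, \<pi> v) = x (v, \<pi> u) - x (v, \<pi> v)"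
        using row by simp
    next
      fix a
      have "Pin a \<in> R" by (auto simp: R_def rows_def)
      from *[OF this] show "x (v0, a) = 0"
        by (simp add: r_def row_sum_Pin[OF \<open>finite V\<close> \<open>v0 \<in> V\<close>])
    next
      fix a b
      have "Rot a b \<in> R" by (auto simp: R_def rows_def)
      from *[OF this] show "(\<Sum>w\<in>V. (of_bool (a = \<pi> w) - of_bool (a = \<pi> v0)) * x (w, b)
        - (of_bool (b = \<pi> w) - of_bool (b = \<pi> v0)) * x (w, a)) = 0"
        by (simp add: r_def row_sum_Rot P_def)
    qed
  qed (auto intro: continuous_on_mult continuous_on_diff)
  then obtain D where "D \<in> {f :: real \<Rightarrow> real. continuous_on UNIV f} \<and> D 0 \<noteq> 0 \<and>
    (\<forall>t. D t \<noteq> 0 \<longrightarrow> rows_control_coords (V \<times> UNIV) R (\<lambda>\<rho> j. r \<rho> j t))"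
    unfolding Bex_def ..
  then have D: "continuous_on UNIV D" "D 0 \<noteq> 0"
    and DK: "\<And>t. D t \<noteq> 0 \<Longrightarrow> rows_control_coords (V \<times> UNIV) R (\<lambda>\<rho> j. r \<rho> j t)"
    by auto
  have "(D \<longlongrightarrow> D 0) (at 0)"
    using D(1) by (simp add: continuous_on_eq_continuous_at isCont_def)
  then have "eventually (\<lambda>t. D t \<noteq> 0 \<and> t \<noteq> 0) (at 0)"
    using D(2) by (intro eventually_conj tendsto_imp_eventually_ne eventually_neq_at_within)
  then obtain t where t: "D t \<noteq> 0" "t \<noteq> 0"
    using eventually_happens'[OF at_neq_bot] by blast
  from DK[OF t(1)] obtain K where K: "\<And>x j. j \<in> V \<times> UNIV \<Longrightarrow>
    \<bar>x j\<bar> \<le> K * (\<Sum>\<rho>\<in>R. \<bar>\<Sum>j\<in>V \<times> UNIV. r \<rho> j t * x j\<bar>)"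
    unfolding rows_control_coords_def by blast
  show ?thesis
  proof (intro exI[of _ "P t"] allI impI ballI)
    fix x :: "nat \<times> 'd \<Rightarrow> real" and j :: "nat \<times> 'd"
    assume *: "\<forall>\<rho>\<in>rows V E. (\<Sum>j\<in>V \<times> UNIV. row_coeff v0 (P t) \<rho> j * x j) = 0"
      and j: "j \<in> V \<times> UNIV"
    have "(\<Sum>j\<in>V \<times> UNIV. r \<rho> j t * x j) = 0" if "\<rho> \<in> R" for \<rho>
    proof (cases "\<exists>u v. \<rho> = Edge u v \<and> \<pi> u = \<pi> v")
      case True
      then obtain u v where \<rho>: "\<rho> = Edge u v" "\<pi> u = \<pi> v" by blast
      with that have uv: "u \<in> V" "v \<in> V" by (auto simp: R_def rows_def)
      have "(\<Sum>j\<in>V \<times> UNIV. row_coeff v0 (P t) \<rho> j * x j)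
          = (\<Sum>c\<in>UNIV. if c = \<pi> u then t * (real u - real v) * (x (u, c) - x (v, c)) else 0)"
        unfolding \<rho>(1) row_sum_Edge[OF \<open>finite V\<close> uv]
        by (intro sum.cong) (auto simp: P_def \<rho>(2) algebra_simps)
      also have "\<dots> = t * (real u - real v) * (x (u, \<pi> u) - x (v, \<pi> u))" by simp
      \<comment> \<open>The case \<open>u = v\<close> arises because singletons in \<open>E\<close>
        are not excluded; the rescaled row is then zero.\<close>
      finally have "u = v \<or> x (u, \<pi> u) = x (v, \<pi> u)" using * that t(2) by (auto simp: R_def)
      then show ?thesis using r_same[OF uv \<rho>(2)] unfolding \<rho>(1) by auto
    next
      case False
      then have "r \<rho> j t = row_coeff v0 (P t) \<rho> j" for j
        by (cases \<rho>) (auto simp: r_def)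
      then show ?thesis using * that by (simp add: R_def)
    qed
    then have "(\<Sum>\<rho>\<in>R. \<bar>\<Sum>j\<in>V \<times> UNIV. r \<rho> j t * x j\<bar>) = 0" by simp
    with K[OF j, of x] show "x j = 0" by simp
  qed
qed

text \<open>The pivot product at an injective placement is a rational polynomial in the coordinates;
  being nonzero there, it is nonzero at every generic placement.\<close>

lemma generic_quantitative_infinitesimal_rigidity:
  fixes \<pi> :: "nat \<Rightarrow> 'd::finite" and p :: "nat \<Rightarrow> real ^ 'd"
  assumes "rigid_partition V \<pi> E" "finite V" "v0 \<in> V" "generic_framework V p"
  shows "rows_control_coords (V \<times> UNIV) (rows V E) (row_coeff v0 (\<lambda>(v, a). p v $ a))"
proof -
  define I where "I = V \<times> (UNIV :: 'd set)"
  obtain P0 where P0: "\<And>x. (\<And>\<rho>. \<rho> \<in> rows V E \<Longrightarrow> (\<Sum>j\<in>I. row_coeff v0 P0 \<rho> j * x j) = 0)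
      \<Longrightarrow> \<forall>j\<in>I. x j = 0"
    using exists_injective_placement[OF assms(1-3)] unfolding I_def by blast
  have "\<exists>D\<in>{F. rat_poly_fun I F}. D P0 \<noteq> 0 \<and>
    (\<forall>P. D P \<noteq> 0 \<longrightarrow> rows_control_coords I (rows V E) (row_coeff v0 P))"
  proof (rule injective_system_stability)
    show "finite I" "finite (rows V E :: (nat, 'd) row set)"
      using \<open>finite V\<close> finite_rows by (auto simp: I_def)
    show "(\<lambda>_. 1) \<in> {F. rat_poly_fun I F}" using rat_poly_fun_const[of I 1] by simp
    fix \<rho> :: "(nat, 'd) row" and j assume \<rho>: "\<rho> \<in> rows V E" "j \<in> I"
    obtain w c where j: "j = (w, c)" by (cases j)
    have const: "rat_poly_fun I (\<lambda>P. 0)" "rat_poly_fun I (\<lambda>P. 1)"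
      using rat_poly_fun_const[of I 0] rat_poly_fun_const[of I 1] by simp_all
    show "(\<lambda>P. row_coeff v0 P \<rho> j) \<in> {F. rat_poly_fun I F}"
      using \<rho> \<open>v0 \<in> V\<close> unfolding mem_Collect_eq j
      by (cases \<rho>) (auto simp: rows_def I_def intro!: rat_poly_fun_diff rat_poly_fun_mult
        rat_poly_fun_var const[unfolded I_def])
  qed (use P0 in \<open>auto intro: rat_poly_fun_diff rat_poly_fun_mult\<close>)
  then obtain D where D: "rat_poly_fun I D" "D P0 \<noteq> 0" and
    DK: "\<And>P. D P \<noteq> 0 \<Longrightarrow> rows_control_coords I (rows V E) (row_coeff v0 P)"
    by blast
  have "D (\<lambda>(v, a). p v $ a) \<noteq> 0"
    by (rule rat_poly_fun_nonzero_at_independent[where F = D and y = P0 and I = I, OF _ D])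
      (use assms(4) in \<open>simp add: generic_framework_def I_def\<close>)
  from DK[OF this] show ?thesis unfolding I_def .
qed

section \<open>From infinitesimal to local rigidity\<close>

text \<open>Preserving the norm of each vector is a closed condition, and every column is the image
  of a unit vector, which bounds the entries by 1.\<close>

lemma compact_norm_preserving_matrices:
  "compact {Q :: real ^ 'd ^ 'd::finite. \<forall>x. norm (Q *v x) = norm x}"
proof -
  let ?O = "{Q :: real ^ 'd ^ 'd. \<forall>x. norm (Q *v x) = norm x}"
  have "closed ?O"
    by (intro closed_Collect_all closed_Collect_eq)
      (auto simp: matrix_vector_mult_def intro!: continuous_intros)
  moreover have "bounded ?O"
    unfolding bounded_iff
  proof (intro exI ballI)
    fix Q :: "real ^ 'd ^ 'd" assume "Q \<in> ?O"
    then have Q: "norm (Q *v x) = norm x" for x by simp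
    have entry: "\<bar>Q $ i $ j\<bar> \<le> 1" for i j
    proof -
      have "Q $ i $ j = (Q *v axis j 1) $ i"
        by (simp add: matrix_vector_mult_def axis_def if_distrib cong: if_cong)
      then have "\<bar>Q $ i $ j\<bar> \<le> norm (Q *v axis j 1)" by (metis component_le_norm_cart)
      then show ?thesis by (simp add: Q norm_axis_1)
    qed
    have "norm Q \<le> (\<Sum>i\<in>UNIV. norm (Q $ i))"
      unfolding norm_vec_def by (rule L2_set_le_sum) simp
    also have "\<dots> \<le> (\<Sum>i\<in>(UNIV :: 'd set). \<Sum>j\<in>(UNIV :: 'd set). 1)"
      by (intro sum_mono order.trans[OF norm_le_l1_cart] entry)
    finally show "norm Q \<le> (\<Sum>i\<in>(UNIV :: 'd set). \<Sum>j\<in>(UNIV :: 'd set). 1)" .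
  qed
  ultimately show ?thesis using compact_eq_bounded_closed by blast
qed

text \<open>The orthogonal Procrustes problem: maximise the correlation \<open>g\<close> over the
  compact orthogonal group. Optimality under plane rotations gives the second claim, comparison with
  the identity the third.\<close>

lemma best_alignment:
  fixes P Z :: "'v \<Rightarrow> real ^ 'd::finite"
  obtains Q :: "real ^ 'd ^ 'd" where "\<And>x. norm (Q *v x) = norm x"
    and "\<And>a b. (\<Sum>v\<in>V. P v $ a * (Q *v Z v) $ b - P v $ b * (Q *v Z v) $ a) = 0"
    and "(\<Sum>v\<in>V. (norm (Q *v Z v - P v))\<^sup>2) \<le> (\<Sum>v\<in>V. (norm (Z v - P v))\<^sup>2)"
proof -
  let ?O = "{Q :: real ^ 'd ^ 'd. \<forall>x. norm (Q *v x) = norm x}"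
  define g where "g Q = (\<Sum>v\<in>V. P v \<bullet> (Q *v Z v))" for Q :: "real ^ 'd ^ 'd"
  have "\<exists>Q\<in>?O. \<forall>Q'\<in>?O. g Q' \<le> g Q"
  proof (rule continuous_attains_sup[OF compact_norm_preserving_matrices])
    show "?O \<noteq> {}" by (auto intro!: exI[of _ "mat 1"])
    show "continuous_on ?O g"
      unfolding g_def by (auto simp: matrix_vector_mult_def intro!: continuous_intros)
  qed
  then obtain Q where Q: "\<And>x. norm (Q *v x) = norm x"
    and max: "\<And>Q'. (\<And>x. norm (Q' *v x) = norm x) \<Longrightarrow> g Q' \<le> g Q" by auto
  \<comment> \<open>The norms of \<open>Z\<close> and \<open>P\<close> are fixed, so maximal
    correlation means minimal distance.\<close>
  have expand: "(\<Sum>v\<in>V. (norm (Q' *v Z v - P v))\<^sup>2)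
      = (\<Sum>v\<in>V. (norm (Z v))\<^sup>2 + (norm (P v))\<^sup>2) - 2 * g Q'"
    if "\<And>x. norm (Q' *v x) = norm x" for Q'
  proof -
    have "(norm (Q' *v z - y))\<^sup>2 = (norm z)\<^sup>2 + (norm y)\<^sup>2 - 2 * (y \<bullet> (Q' *v z))" for z y
      using dot_norm_neg[of "Q' *v z" y] that[of z] by (simp add: inner_commute)
    then show ?thesis by (simp add: g_def sum_subtractf sum_distrib_left)
  qed
  have "g (mat 1) \<le> g Q" by (rule max) simp
  then have 1: "(\<Sum>v\<in>V. (norm (Q *v Z v - P v))\<^sup>2) \<le> (\<Sum>v\<in>V. (norm (Z v - P v))\<^sup>2)"
    using expand[OF Q] expand[of "mat 1"] by simp
  have 2: "(\<Sum>v\<in>V. P v $ a * (Q *v Z v) $ b - P v $ b * (Q *v Z v) $ a) = 0" for a b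
  proof (cases "a = b")
    case False
    define \<alpha> where "\<alpha> = (\<Sum>v\<in>V. P v $ a * (Q *v Z v) $ a + P v $ b * (Q *v Z v) $ b)"
    define \<beta> where "\<beta> = (\<Sum>v\<in>V. P v $ a * (Q *v Z v) $ b - P v $ b * (Q *v Z v) $ a)"
    \<comment> \<open>Compare \<open>Q\<close> with its composition with rotations in the plane of the coordinates \<open>a, b\<close>.\<close>
    have rot: "c * \<alpha> - s * \<beta> \<le> \<alpha>" if cs: "c\<^sup>2 + s\<^sup>2 = 1" for c s :: real
    proof -
      \<comment> \<open>The rotation with cosine \<open>c\<close> and sine \<open>s\<close>, written
        as the identity plus a correction so that only the coordinates \<open>a\<close> and
        \<open>b\<close> enter the computations.\<close>
      define R where "R y = y + ((c - 1) * y $ a - s * y $ b) *\<^sub>R axis a 1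
        + (s * y $ a + (c - 1) * y $ b) *\<^sub>R axis b 1" for y :: "real ^ 'd"
      have "linear R"
        by (rule linearI) (auto simp: R_def algebra_simps scaleR_add_left scaleR_diff_left)
      then have mR: "matrix R *v y = R y" for y
        by (intro matrix_works) (simp add: linear_matrix_vector_mul_eq)
      have nR: "norm (R y) = norm y" for y
      proof -
        define A B where "A = (c - 1) * y $ a - s * y $ b" and "B = s * y $ a + (c - 1) * y $ b"
        have "axis a (1 :: real) $ b = 0" "axis b (1 :: real) $ a = 0"
          using False by (simp_all add: axis_def)
        then have "R y \<bullet> R y = y \<bullet> y + (2 * A * y $ a + 2 * B * y $ b + A\<^sup>2 + B\<^sup>2)"
          by (simp add: R_def flip: A_def B_def)
            (simp add: inner_add_left inner_add_right inner_axis inner_axis' algebra_simps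
              power2_eq_square)
        also have "2 * A * y $ a + 2 * B * y $ b + A\<^sup>2 + B\<^sup>2
            = (c\<^sup>2 + s\<^sup>2 - 1) * ((y $ a)\<^sup>2 + (y $ b)\<^sup>2)"
          by (simp add: A_def B_def power2_eq_square algebra_simps)
        finally show ?thesis using cs by (simp add: norm_eq_sqrt_inner)
      qed
      have "g (matrix R ** Q) \<le> g Q"
        by (rule max) (simp add: mR nR Q flip: matrix_vector_mul_assoc)
      moreover have "g (matrix R ** Q) = (\<Sum>v\<in>V. P v \<bullet> R (Q *v Z v))"
        by (simp add: g_def mR flip: matrix_vector_mul_assoc)
      moreover have "x \<bullet> R y = x \<bullet> y + (c - 1) * (x $ a * y $ a + x $ b * y $ b)
          - s * (x $ a * y $ b - x $ b * y $ a)" for x y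
        by (simp add: R_def inner_add_right inner_axis algebra_simps)
      ultimately show ?thesis
        by (simp add: g_def \<alpha>_def \<beta>_def sum.distrib sum_subtractf algebra_simps
          flip: sum_distrib_left)
    qed
    have "\<beta> = 0"
    proof (rule ccontr)
      assume "\<beta> \<noteq> 0"
      \<comment> \<open>Taking \<open>c = \<alpha> / r\<close> and \<open>s = - \<beta> / r\<close>
        turns \<open>c * \<alpha> - s * \<beta>\<close> into \<open>r\<close>, which exceeds
        \<open>\<alpha>\<close> when \<open>\<beta> \<noteq> 0\<close>.\<close>
      define r where "r = sqrt (\<alpha>\<^sup>2 + \<beta>\<^sup>2)"
      have r2: "r\<^sup>2 = \<alpha>\<^sup>2 + \<beta>\<^sup>2" by (simp add: r_def)
      have "r > 0" using \<open>\<beta> \<noteq> 0\<close> by (simp add: r_def sum_power2_gt_zero_iff)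
      have "(\<alpha> / r)\<^sup>2 + (- \<beta> / r)\<^sup>2 = (\<alpha>\<^sup>2 + \<beta>\<^sup>2) / r\<^sup>2"
        by (simp add: power_divide add_divide_distrib)
      also have "\<dots> = 1" using \<open>r > 0\<close> by (simp flip: r2)
      finally have "(\<alpha> / r)\<^sup>2 + (- \<beta> / r)\<^sup>2 = 1" .
      from rot[OF this] have "(\<alpha>\<^sup>2 + \<beta>\<^sup>2) / r \<le> \<alpha>"
        by (simp add: power2_eq_square add_divide_distrib)
      then have "r \<le> \<alpha>"
        unfolding r2[symmetric] using \<open>r > 0\<close> by (simp add: power2_eq_square)
      then have "r\<^sup>2 \<le> \<alpha>\<^sup>2" using \<open>r > 0\<close> by (intro power_mono) auto
      then show False using r2 \<open>\<beta> \<noteq> 0\<close> by simp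
    qed
    then show ?thesis by (simp add: \<beta>_def)
  qed simp
  show thesis by (rule that[OF Q 2 1])
qed

text \<open>In the application \<open>Q\<close> turns the moved framework towards the original one,
  whereas \<open>T\<close> goes the other way; hence the inverse of \<open>Q\<close>.\<close>

lemma isometry_of_norm_preserving:
  fixes Q :: "real ^ 'd ^ 'd::finite"
  assumes "\<And>x. norm (Q *v x) = norm x"
  shows "\<exists>T. (\<forall>x y. dist (T x) (T y) = dist x y) \<and> (\<forall>z. T (b + Q *v z) = c + z)"
proof -
  have orth: "orthogonal_transformation ((*v) Q)"
    using assms by (simp add: orthogonal_transformation)
  then have orth': "orthogonal_transformation (inv ((*v) Q))"
    by (rule orthogonal_transformation_inv)
  have inv: "inv ((*v) Q) (Q *v z) = z" for z
    using orthogonal_transformation_inj[OF orth] by (rule inv_f_f)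
  show ?thesis
    by (intro exI[of _ "\<lambda>x. c + inv ((*v) Q) (x - b)"])
      (use orthogonal_transformation_isometry[THEN iffD1, OF orth'] in \<open>simp add: inv dist_norm\<close>)
qed

section \<open>Local rigidity from a linear bound against a quadratic one\<close>

text \<open>With \<open>S\<close> the squared size of the aligned displacement, all row values are
  at most \<open>2 * S\<close>, so control bounds \<open>S\<close> by a constant times
  \<open>S * S\<close>; a small \<open>S\<close> is then 0.\<close>

lemma rigid_framework_if_rows_control_coords:
  fixes p :: "'v \<Rightarrow> real ^ 'd::finite"
  assumes "finite V" "v0 \<in> V"
    and control: "rows_control_coords (V \<times> UNIV) (rows V E) (row_coeff v0 (\<lambda>(v, a). p v $ a))"
  shows "rigid_framework V E p"
proof -
  let ?J = "V \<times> (UNIV :: 'd set)" and ?R = "rows V E :: ('v, 'd) row set"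
  let ?L = "\<lambda>\<rho> x. \<Sum>j\<in>?J. row_coeff v0 (\<lambda>(v, a). p v $ a) \<rho> j * x j"
  obtain K where K: "K \<ge> 0" "\<And>x j. j \<in> ?J \<Longrightarrow> \<bar>x j\<bar> \<le> K * (\<Sum>\<rho>\<in>?R. \<bar>?L \<rho> x\<bar>)"
    using control unfolding rows_control_coords_def by blast
  \<comment> \<open>\<open>B * S\<close> will bound each coordinate; \<open>X\<close> collects the
    remaining factors, and \<open>\<delta>\<close> is chosen so that
    \<open>X * (2 * \<delta>)\<^sup>2 < 1\<close> contradicts a nonzero \<open>S\<close>.\<close>
  define B where "B = K * (real (card ?R) * 2)"
  define X where "X = (real (card ?J) * B\<^sup>2) * real (card V)"
  have "X \<ge> 0" by (simp add: X_def)
  define \<delta> where "\<delta> = 1 / (4 * (1 + X))"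
  have "\<delta> > 0" using \<open>X \<ge> 0\<close> by (simp add: \<delta>_def)
  have X\<delta>: "X * (2 * \<delta>)\<^sup>2 < 1"
  proof -
    have "2 * \<delta> \<le> 1" "X * (2 * \<delta>) < 1" "2 * \<delta> \<ge> 0"
      using \<open>X \<ge> 0\<close> by (simp_all add: \<delta>_def field_simps)
    then have "X * (2 * \<delta>) * (2 * \<delta>) < 1"
      by (smt (verit) \<open>X \<ge> 0\<close> mult_left_le mult_nonneg_nonneg)
    then show ?thesis by (simp add: power2_eq_square mult.assoc)
  qed
  define U where "U = PiE V (\<lambda>v. ball (p v) \<delta>)"
  have "openin (product_topology (\<lambda>_. euclidean) V) U"
    unfolding U_def using \<open>finite V\<close> by (subst openin_PiE) auto
  moreover have "restrict p V \<in> U" using \<open>\<delta> > 0\<close> by (auto simp: U_def)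
  moreover have "\<exists>T :: real ^ 'd \<Rightarrow> real ^ 'd.
      (\<forall>x y. dist (T x) (T y) = dist x y) \<and> (\<forall>i\<in>V. q i = T (p i))"
    if "q \<in> U" and q: "\<forall>i j. {i, j} \<in> E \<longrightarrow> norm (q i - q j) = norm (p i - p j)" for q
  proof -
    define Z P where "Z v = q v - q v0" and "P v = p v - p v0" for v
    obtain Q :: "real ^ 'd ^ 'd" where Q: "\<And>x. norm (Q *v x) = norm x"
      and rot: "\<And>a b. (\<Sum>v\<in>V. P v $ a * (Q *v Z v) $ b - P v $ b * (Q *v Z v) $ a) = 0"
      and le: "(\<Sum>v\<in>V. (norm (Q *v Z v - P v))\<^sup>2) \<le> (\<Sum>v\<in>V. (norm (Z v - P v))\<^sup>2)"
      using best_alignment[of P Z V] by blast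
    define y where "y v = Q *v Z v - P v" for v
    define x where "x = (\<lambda>(v, a). y v $ a)"
    define S where "S = (\<Sum>v\<in>V. (norm (y v))\<^sup>2)"
    have "S \<ge> 0" by (simp add: S_def sum_nonneg)
    have yS: "(norm (y v))\<^sup>2 \<le> S" if "v \<in> V" for v
      unfolding S_def using that \<open>finite V\<close> by (intro member_le_sum) auto
    \<comment> \<open>Twice \<open>\<delta>\<close>, because both \<open>v\<close> and the pinned
      vertex may move.\<close>
    have "norm (Z v - P v) \<le> 2 * \<delta>" if "v \<in> V" for v
    proof -
      have "norm (q w - p w) \<le> \<delta>" if "w \<in> V" for w
        using that \<open>q \<in> U\<close> by (auto simp: U_def PiE_iff dist_norm norm_minus_commute less_imp_le)
      from this[OF \<open>v \<in> V\<close>] this[OF \<open>v0 \<in> V\<close>] show ?thesis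
        using norm_triangle_ineq4[of "q v - p v" "q v0 - p v0"]
        by (simp add: Z_def P_def algebra_simps)
    qed
    then have "(\<Sum>v\<in>V. (norm (Z v - P v))\<^sup>2) \<le> real (card V) * (2 * \<delta>)\<^sup>2"
      by (intro sum_bounded_above power_mono) auto
    with le have S_le: "S \<le> real (card V) * (2 * \<delta>)\<^sup>2" by (simp add: S_def y_def)
    \<comment> \<open>By equality of lengths an edge row equals
      \<open>- (norm (y u - y v))\<^sup>2 / 2\<close>; the \<open>Pin\<close> rows vanish since
      \<open>y v0 = 0\<close>, the \<open>Rot\<close> rows by the choice of
      \<open>Q\<close>.\<close>
    have row: "\<bar>?L \<rho> x\<bar> \<le> 2 * S" if \<rho>: "\<rho> \<in> ?R" for \<rho>
    proof (cases \<rho>)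
      case (Edge u v)
      with \<rho> have uv: "u \<in> V" "v \<in> V" "{u, v} \<in> E" by (auto simp: rows_def)
      have "?L \<rho> x = (P u - P v) \<bullet> (y u - y v)"
        unfolding Edge row_sum_Edge[OF \<open>finite V\<close> uv(1,2)]
        by (simp add: x_def P_def inner_vec_def)
      moreover have "(norm ((P u - P v) + (y u - y v)))\<^sup>2 = (norm (P u - P v))\<^sup>2"
      proof -
        have "(P u - P v) + (y u - y v) = Q *v (Z u - Z v)"
          by (simp add: y_def matrix_vector_mult_diff_distrib)
        then have "norm ((P u - P v) + (y u - y v)) = norm (q u - q v)"
          by (simp add: Q Z_def)
        then show ?thesis using q uv(3) by (simp add: P_def)
      qed
      moreover have "norm (y u - y v) ^ 2 \<le> 4 * S"
      proof -
        have "norm (y u - y v) ^ 2 \<le> (norm (y u) + norm (y v))\<^sup>2"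
          by (intro power_mono norm_triangle_ineq4) auto
        also have "\<dots> \<le> 2 * (norm (y u))\<^sup>2 + 2 * (norm (y v))\<^sup>2"
          using sum_squares_bound[of "norm (y u)" "norm (y v)"]
          by (simp add: power2_sum)
        finally show ?thesis using yS[OF uv(1)] yS[OF uv(2)] by simp
      qed
      ultimately show ?thesis
        using dot_norm[of "P u - P v" "y u - y v"] by (simp only:) simp
    next
      case (Pin a)
      then show ?thesis
        using \<open>S \<ge> 0\<close> by (simp add: row_sum_Pin[OF \<open>finite V\<close> \<open>v0 \<in> V\<close>] x_def y_def Z_def P_def)
    next
      case (Rot a b)
      have "?L \<rho> x = (\<Sum>w\<in>V. P w $ a * y w $ b - P w $ b * y w $ a)"
        unfolding Rot row_sum_Rot by (simp add: x_def P_def)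
      also have "\<dots> = (\<Sum>v\<in>V. P v $ a * (Q *v Z v) $ b - P v $ b * (Q *v Z v) $ a)"
        by (intro sum.cong) (auto simp: y_def algebra_simps)
      finally show ?thesis using rot[of a b] \<open>S \<ge> 0\<close> by simp
    qed
    have xB: "\<bar>x j\<bar> \<le> B * S" if "j \<in> ?J" for j
    proof -
      have "\<bar>x j\<bar> \<le> K * (\<Sum>\<rho>\<in>?R. \<bar>?L \<rho> x\<bar>)" by (rule K(2)[OF that])
      also have "\<dots> \<le> K * (real (card ?R) * (2 * S))"
        using row by (intro mult_left_mono sum_bounded_above K(1)) auto
      finally show ?thesis by (simp add: B_def mult_ac)
    qed
    have "S = (\<Sum>j\<in>?J. (x j)\<^sup>2)"
      by (simp add: S_def x_def sum_vertex_coords norm_eq_sqrt_inner inner_vec_def sum_nonneg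
        power2_eq_square)
    also have "\<dots> \<le> real (card ?J) * (B * S)\<^sup>2"
    proof (rule sum_bounded_above)
      show "(x j)\<^sup>2 \<le> (B * S)\<^sup>2" if "j \<in> ?J" for j
        using power_mono[OF xB[OF that], of 2] by simp
    qed
    finally have S_sq: "S \<le> (real (card ?J) * B\<^sup>2) * S * S"
      by (simp add: power2_eq_square mult_ac)
    have "S = 0"
    proof (rule ccontr)
      assume "S \<noteq> 0"
      with \<open>S \<ge> 0\<close> S_sq have "1 \<le> (real (card ?J) * B\<^sup>2) * S" by simp
      also have "\<dots> \<le> (real (card ?J) * B\<^sup>2) * (real (card V) * (2 * \<delta>)\<^sup>2)"
        by (intro mult_left_mono S_le) simp
      also have "\<dots> = X * (2 * \<delta>)\<^sup>2" by (simp add: X_def)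
      finally show False using X\<delta> by simp
    qed
    then have y0: "y v = 0" if "v \<in> V" for v using yS[OF that] by simp
    obtain T where T: "\<forall>x y. dist (T x) (T y) = dist x y" "\<And>z. T (p v0 + Q *v z) = q v0 + z"
      using isometry_of_norm_preserving[OF Q, of "p v0" "q v0"] by blast
    have "q v = T (p v)" if "v \<in> V" for v
    proof -
      have "p v = p v0 + Q *v Z v" using y0[OF that] by (simp add: y_def P_def)
      then show ?thesis using T(2)[of "Z v"] by (simp add: Z_def)
    qed
    with T(1) show ?thesis by blast
  qed
  ultimately show ?thesis unfolding rigid_framework_def by blast
qed

theorem rigid_graph_if_rigid_partition:
  fixes \<pi> :: "nat \<Rightarrow> 'd::finite"
  assumes "finite V" "rigid_partition V \<pi> E"
  shows "rigid_graph TYPE('d) V E"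
  unfolding rigid_graph_def
proof (intro allI impI)
  fix p :: "nat \<Rightarrow> real ^ 'd" assume "generic_framework V p"
  moreover obtain v0 where "v0 \<in> V" using assms(2) unfolding rigid_partition_def by blast
  ultimately show "rigid_framework V E p"
    using assms by (intro rigid_framework_if_rows_control_coords[of V v0]
      generic_quantitative_infinitesimal_rigidity)
qed

section \<open>Random graphs\<close>

lemma finite_vertex_pairs: "finite V \<Longrightarrow> finite (vertex_pairs V)"
  unfolding vertex_pairs_def by (rule finite_subset[of _ "Pow V"]) auto

section \<open>Edges missing across a cut\<close>

text \<open>The event is a box in the product space: the pairs in \<open>F\<close> are absent, the
  others are free.\<close>

lemma prob_erdos_renyi_avoids:
  assumes F: "F \<subseteq> vertex_pairs {..<n}" and p: "0 \<le> p" "p \<le> 1"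
  shows "measure_pmf.prob (erdos_renyi n p) {E. F \<inter> E = {}} = (1 - p) ^ card F"
proof -
  let ?A = "vertex_pairs {..<n}"
  have fin: "finite ?A" by (simp add: finite_vertex_pairs)
  have "(\<lambda>f. {e \<in> ?A. f e}) -` {E. F \<inter> E = {}} = Pi ?A (\<lambda>e. if e \<in> F then {False} else UNIV)"
    using F by (auto simp: Pi_def split: if_splits)
  then have "measure_pmf.prob (erdos_renyi n p) {E. F \<inter> E = {}}
      = (\<Prod>e\<in>?A. measure_pmf.prob (bernoulli_pmf p) (if e \<in> F then {False} else UNIV))"
    by (simp add: erdos_renyi_def measure_map_pmf measure_Pi_pmf_Pi[OF fin])
  also have "\<dots> = (\<Prod>e\<in>?A. if e \<in> F then 1 - p else 1)"
    using p by (intro prod.cong) (auto simp: measure_pmf_single)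
  also have "\<dots> = (\<Prod>e\<in>?A \<inter> F. 1 - p)"
    by (simp only: prod.inter_restrict[OF fin])
  finally show ?thesis using F by (simp add: Int_absorb1)
qed

text \<open>Exactly one endpoint lies in \<open>S\<close>, so the unordered pair determines the
  ordered one.\<close>

lemma card_unordered_crossing_pairs:
  assumes "X \<subseteq> S \<times> (W - S)"
  shows "card ((\<lambda>(u, v). {u, v}) ` X) = card X"
  by (intro card_image inj_onI) (auto simp: doubleton_eq_iff dest!: subsetD[OF assms])

text \<open>Expanding the product of the factors \<open>1 + x\<close> over \<open>W\<close> gives
  the sum over all subsets; the 1 removed is the term of the empty set.\<close>

lemma sum_nonempty_subsets_power:
  assumes "finite W" "x \<ge> (0 :: real)" "\<S> \<subseteq> Pow W - {{}}"
  shows "(\<Sum>S\<in>\<S>. x ^ card S) \<le> (1 + x) ^ card W - 1"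
proof -
  have "(\<Sum>S\<in>\<S>. x ^ card S) \<le> (\<Sum>S\<in>Pow W - {{}}. x ^ card S)"
    using assms by (intro sum_mono2) auto
  also have "\<dots> = (\<Sum>S\<in>Pow W. x ^ card S) - 1"
    using assms(1) by (subst sum_diff1) auto
  also have "(\<Sum>S\<in>Pow W. x ^ card S) = (\<Prod>v\<in>W. x + 1)"
    by (subst prod_add[OF assms(1)]) simp
  finally show ?thesis by (simp add: add.commute)
qed

text \<open>Union bound over cuts. Symmetry of \<open>H\<close> lets the smaller side
  \<open>S\<close> represent the cut; its at least \<open>c * card S\<close> pairs are all absent
  with probability at most \<open>exp (- (p * c)) ^ card S\<close>.\<close>

lemma prob_not_cut_connected:
  fixes c :: real
  assumes W: "W \<subseteq> {..<n}" and p: "0 \<le> p" "p \<le> 1" and sym: "\<And>u v. H u v \<Longrightarrow> H v u"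
    and expand: "\<And>S. S \<subseteq> W \<Longrightarrow> 2 * card S \<le> card W \<Longrightarrow>
      c * real (card S) \<le> real (card {(u, v). u \<in> S \<and> v \<in> W - S \<and> H u v})"
  shows "measure_pmf.prob (erdos_renyi n p) {E. \<not> cut_connected W H E}
    \<le> (1 + exp (- (p * c))) ^ card W - 1"
proof -
  have fin: "finite W" using W finite_subset by blast
  define X where "X S = {(u, v). u \<in> S \<and> v \<in> W - S \<and> H u v}" for S
  define F where "F S = (\<lambda>(u, v). {u, v}) ` X S" for S
  define \<S> where "\<S> = {S. S \<subseteq> W \<and> S \<noteq> {} \<and> 2 * card S \<le> card W}"
  have finS: "finite \<S>" using fin by (auto simp: \<S>_def)
  have sub: "{E. \<not> cut_connected W H E} \<subseteq> (\<Union>S\<in>\<S>. {E. F S \<inter> E = {}})"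
  proof
    fix E assume "E \<in> {E. \<not> cut_connected W H E}"
    then obtain S where S: "S \<subseteq> W" "S \<noteq> {}" "S \<noteq> W"
      "\<And>u v. u \<in> S \<Longrightarrow> v \<in> W - S \<Longrightarrow> H u v \<Longrightarrow> {u, v} \<notin> E"
      unfolding cut_connected_def by blast
    have "card (W - S) = card W - card S" "card S \<le> card W"
      using S(1) fin by (auto simp: card_Diff_subset finite_subset card_mono)
    then consider "S \<in> \<S>" | "W - S \<in> \<S>" using S by (fastforce simp: \<S>_def)
    then show "E \<in> (\<Union>S\<in>\<S>. {E. F S \<inter> E = {}})"
    proof cases
      case 1
      moreover have "F S \<inter> E = {}" using S(4) by (auto simp: F_def X_def)
      ultimately show ?thesis by blast
    next
      case 2
      have "{u, v} \<notin> E" if "u \<in> W - S" "v \<in> S" "H u v" for u v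
        using S(4)[of v u] sym that by (simp add: insert_commute)
      then have "F (W - S) \<inter> E = {}" using S(1) by (auto simp: F_def X_def)
      with 2 show ?thesis by blast
    qed
  qed
  have le: "measure_pmf.prob (erdos_renyi n p) {E. F S \<inter> E = {}} \<le> exp (- (p * c)) ^ card S"
    if "S \<in> \<S>" for S
  proof -
    have "F S \<subseteq> vertex_pairs {..<n}"
      using that W by (auto simp: F_def X_def \<S>_def vertex_pairs_def card_insert_if)
    then have "measure_pmf.prob (erdos_renyi n p) {E. F S \<inter> E = {}} = (1 - p) ^ card (F S)"
      by (rule prob_erdos_renyi_avoids) (use p in auto)
    also have "card (F S) = card (X S)"
      unfolding F_def by (rule card_unordered_crossing_pairs) (auto simp: X_def)
    also have "(1 - p) ^ card (X S) \<le> exp (- p) ^ card (X S)"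
      using p exp_ge_add_one_self[of "- p"] by (intro power_mono) auto
    also have "\<dots> = exp (- (p * real (card (X S))))"
      by (simp add: exp_of_nat_mult[symmetric] mult.commute)
    also have "\<dots> \<le> exp (- (p * (c * real (card S))))"
      using expand[of S] that p by (simp add: X_def \<S>_def mult_left_mono)
    also have "\<dots> = exp (- (p * c)) ^ card S"
      by (simp add: exp_of_nat_mult[symmetric] mult_ac)
    finally show ?thesis .
  qed
  have "measure_pmf.prob (erdos_renyi n p) {E. \<not> cut_connected W H E}
      \<le> measure_pmf.prob (erdos_renyi n p) (\<Union>S\<in>\<S>. {E. F S \<inter> E = {}})"
    by (intro measure_pmf.finite_measure_mono sub) simp
  also have "\<dots> \<le> (\<Sum>S\<in>\<S>. measure_pmf.prob (erdos_renyi n p) {E. F S \<inter> E = {}})"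
    by (intro measure_pmf.finite_measure_subadditive_finite finS) auto
  also have "\<dots> \<le> (\<Sum>S\<in>\<S>. exp (- (p * c)) ^ card S)"
    by (intro sum_mono le)
  also have "\<dots> \<le> (1 + exp (- (p * c))) ^ card W - 1"
    by (intro sum_nonempty_subsets_power fin) (auto simp: \<S>_def)
  finally show ?thesis .
qed

section \<open>Cuts of balanced classes\<close>

text \<open>For \<open>i = j\<close> at least half of the class lies outside \<open>S\<close>. For
  \<open>i \<noteq> j\<close>, if \<open>S\<close> has \<open>a\<close> and \<open>b\<close>
  vertices in the two classes, at least \<open>m * (a + b) - 2 * (a * b)\<close> pairs cross; then
  \<open>4 * (a * b) \<le> (a + b)\<^sup>2\<close> and \<open>a + b \<le> m + 1\<close>
  suffice.\<close>

lemma card_crossing_pairs_ge: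
  fixes \<pi> :: "'v \<Rightarrow> 'd" and i j :: 'd
  assumes "finite V"
    and size: "\<And>i. m \<le> card {v\<in>V. \<pi> v = i}" "\<And>i. card {v\<in>V. \<pi> v = i} \<le> m + 1"
  defines "W \<equiv> {v\<in>V. \<pi> v = i \<or> \<pi> v = j}"
  assumes S: "S \<subseteq> W" "2 * card S \<le> card W"
  shows "(real m - 1) / 2 * real (card S)
    \<le> real (card {(u, v). u \<in> S \<and> v \<in> W - S \<and> (\<pi> u = \<pi> v \<longleftrightarrow> i = j)})"
proof -
  have fin: "finite W" "finite S"
    using \<open>finite V\<close> S(1) unfolding W_def by (auto intro: finite_subset)
  show ?thesis
  proof (cases "i = j")
    case True
    have "{(u, v). u \<in> S \<and> v \<in> W - S \<and> (\<pi> u = \<pi> v \<longleftrightarrow> i = j)} = S \<times> (W - S)"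
      using True S(1) by (auto simp: W_def)
    then have "real (card {(u, v). u \<in> S \<and> v \<in> W - S \<and> (\<pi> u = \<pi> v \<longleftrightarrow> i = j)})
        = real (card S) * (real (card W) - real (card S))"
      using fin S(1) by (simp add: card_cartesian_product card_Diff_subset card_mono of_nat_diff)
    moreover have "m \<le> card W" using size(1)[of i] True by (simp add: W_def)
    then have "(real m - 1) / 2 \<le> real (card W) - real (card S)" using S(2) by simp
    then have "(real m - 1) / 2 * real (card S) \<le> (real (card W) - real (card S)) * real (card S)"
      by (rule mult_right_mono) simp
    ultimately show ?thesis by (simp only: mult.commute)
  next
    case False
    define Vi Vj where "Vi = {v\<in>V. \<pi> v = i}" and "Vj = {v\<in>V. \<pi> v = j}"
    define A B where "A = S \<inter> Vi" and "B = S \<inter> Vj"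
    have finV: "finite Vi" "finite Vj" using \<open>finite V\<close> by (auto simp: Vi_def Vj_def)
    have W: "W = Vi \<union> Vj" "Vi \<inter> Vj = {}" using False by (auto simp: W_def Vi_def Vj_def)
    have AB: "S = A \<union> B" "A \<inter> B = {}" "A \<subseteq> Vi" "B \<subseteq> Vj"
      using S(1) W by (auto simp: A_def B_def)
    have fAB: "finite A" "finite B" using AB finV finite_subset by blast+
    have cS: "card S = card A + card B" unfolding AB(1) using fAB AB(2) by (rule card_Un_disjoint)
    have cW: "card W = card Vi + card Vj" unfolding W(1) using finV W(2) by (rule card_Un_disjoint)
    have sz: "real m \<le> card Vi" "real m \<le> card Vj" "card Vi \<le> real m + 1" "card Vj \<le> real m + 1"
      using size[of i] size[of j] unfolding Vi_def Vj_def by linarith+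
    define a b where "a = real (card A)" and "b = real (card B)"
    have ab: "a \<ge> 0" "b \<ge> 0" by (auto simp: a_def b_def)
    \<comment> \<open>Half of two classes of size at most \<open>m + 1\<close>; this extra 1 is what
      turns \<open>m\<close> into \<open>m - 1\<close> in the bound.\<close>
    have "card A + card B \<le> m + 1"
      using S(2) size(2)[of i] size(2)[of j] unfolding cS cW Vi_def Vj_def by simp
    then have "a + b \<le> real m + 1"
      unfolding a_def b_def by linarith
    then have "(a + b) * (a + b) \<le> (a + b) * (real m + 1)"
      using ab by (intro mult_left_mono) auto
    then have 1: "(real m - 1) / 2 * (a + b) \<le> (a + b) * real m - (a + b)\<^sup>2 / 2"
      by (simp add: power2_eq_square algebra_simps) (simp add: field_simps)
    have "(a + b)\<^sup>2 / 2 \<ge> 2 * (a * b)"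
      using sum_squares_bound[of a b] by (simp add: power2_sum)
    moreover have "a * real m \<le> a * card Vj" "b * real m \<le> b * card Vi"
      using sz ab by (auto intro: mult_left_mono)
    ultimately have "(a + b) * real m - (a + b)\<^sup>2 / 2 \<le> a * (card Vj - b) + b * (card Vi - a)"
      by (simp add: algebra_simps)
    also have "\<dots> = real (card (A \<times> (Vj - B) \<union> B \<times> (Vi - A)))"
    proof -
      have "card (A \<times> (Vj - B) \<union> B \<times> (Vi - A)) = card (A \<times> (Vj - B)) + card (B \<times> (Vi - A))"
        using AB(2) fAB finV by (intro card_Un_disjoint) auto
      then show ?thesis
        using fAB finV AB(3,4)
        by (simp add: card_cartesian_product card_Diff_subset card_mono of_nat_diff a_def b_def)
    qed
    also have "\<dots> \<le> real (card {(u, v). u \<in> S \<and> v \<in> W - S \<and> (\<pi> u = \<pi> v \<longleftrightarrow> i = j)})"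
    proof -
      have "finite {(u, v). u \<in> S \<and> v \<in> W - S \<and> (\<pi> u = \<pi> v \<longleftrightarrow> i = j)}"
        by (rule finite_subset[of _ "S \<times> W"]) (use fin in auto)
      then show ?thesis
        unfolding of_nat_le_iff
        by (rule card_mono) (use False in \<open>auto simp: A_def B_def Vi_def Vj_def W_def\<close>)
    qed
    finally show ?thesis using 1 by (simp add: cS a_def b_def)
  qed
qed

text \<open>Each full block of \<open>d\<close> consecutive numbers contains one member; an
  incomplete last block may add one.\<close>

lemma card_residue_class:
  assumes "r < (d :: nat)"
  shows "n div d \<le> card {v. v < n \<and> v mod d = r}" "card {v. v < n \<and> v mod d = r} \<le> n div d + 1"
proof -
  have inj: "inj_on (\<lambda>q. q * d + r) A" for A
    using assms by (intro inj_onI) auto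
  have fin: "finite {v. v < n \<and> v mod d = r}" by simp
  have "(\<lambda>q. q * d + r) ` {..<n div d} \<subseteq> {v. v < n \<and> v mod d = r}"
  proof clarsimp
    fix q assume "q < n div d"
    then have "Suc q * d \<le> n div d * d" by (intro mult_right_mono) auto
    also have "\<dots> \<le> n" by (rule div_times_less_eq_dividend)
    finally show "q * d + r < n \<and> r mod d = r" using assms by simp
  qed
  from card_mono[OF fin this] show "n div d \<le> card {v. v < n \<and> v mod d = r}"
    by (simp add: card_image[OF inj])
  have "{v. v < n \<and> v mod d = r} \<subseteq> (\<lambda>q. q * d + r) ` {..n div d}"
  proof clarify
    fix v assume "v < n" "r = v mod d"
    then show "v \<in> (\<lambda>q. q * d + v mod d) ` {..n div d}"
      by (intro image_eqI[of _ _ "v div d"]) (auto intro: div_le_mono)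
  qed
  from card_mono[OF _ this] show "card {v. v < n \<and> v mod d = r} \<le> n div d + 1"
    by (simp add: card_image[OF inj])
qed

text \<open>Colour by residues modulo \<open>CARD('d)\<close>, transported to the type
  \<open>'d\<close> by an enumeration.\<close>

lemma exists_balanced_colouring:
  "\<exists>\<pi> :: nat \<Rightarrow> 'd::finite. \<forall>i. n div CARD('d) \<le> card {v\<in>{..<n}. \<pi> v = i}
    \<and> card {v\<in>{..<n}. \<pi> v = i} \<le> n div CARD('d) + 1"
proof -
  obtain f :: "'d \<Rightarrow> nat" where f: "bij_betw f UNIV {0..<CARD('d)}"
    using ex_bij_betw_finite_nat[of "UNIV :: 'd set"] by auto
  define \<pi> where "\<pi> v = inv f (v mod CARD('d))" for v
  have "\<pi> v = i \<longleftrightarrow> v mod CARD('d) = f i" for v i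
  proof -
    have "v mod CARD('d) \<in> f ` UNIV" using f by (simp add: bij_betw_def)
    moreover have "inj f" using f by (simp add: bij_betw_def)
    ultimately show ?thesis unfolding \<pi>_def by (metis f_inv_into_f inv_f_f)
  qed
  moreover have "f i < CARD('d)" for i using f by (auto simp: bij_betw_def)
  ultimately show ?thesis
    using card_residue_class[of _ "CARD('d)" n] by (intro exI[of _ \<pi>]) simp
qed

text \<open>The balanced colouring is fixed before the graph is drawn. Its surjectivity is then
  certain, and failure is a union bound over the \<open>(CARD('d))\<^sup>2\<close> ordered pairs of
  classes.\<close>

lemma prob_rigid_partition:
  assumes p: "0 \<le> p" "p \<le> 1" and n: "CARD('d) \<le> n"
  shows "\<exists>\<pi> :: nat \<Rightarrow> 'd::finite.
    measure_pmf.prob (erdos_renyi n p) {E. rigid_partition {..<n} \<pi> E}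
      \<ge> 1 - (real CARD('d))\<^sup>2 * ((1 + exp (- (p * ((real (n div CARD('d)) - 1) / 2)))) ^ n - 1)"
proof -
  define m where "m = n div CARD('d)"
  have "m \<ge> 1" using n by (simp add: m_def div_greater_zero_iff Suc_le_eq)
  obtain \<pi> :: "nat \<Rightarrow> 'd" where size: "\<And>i. m \<le> card {v\<in>{..<n}. \<pi> v = i}"
    "\<And>i. card {v\<in>{..<n}. \<pi> v = i} \<le> m + 1"
    using exists_balanced_colouring[of n] unfolding m_def by blast
  define W where "W i j = {v\<in>{..<n}. \<pi> v = i \<or> \<pi> v = j}" for i j
  define H where "H i j = (\<lambda>u v. \<pi> u = \<pi> v \<longleftrightarrow> i = j)" for i j :: 'd
  define x where "x = exp (- (p * ((real m - 1) / 2)))"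
  have surj: "\<pi> ` {..<n} = UNIV"
  proof (intro equalityI subsetI UNIV_I)
    fix i
    have "card {v\<in>{..<n}. \<pi> v = i} \<noteq> 0" using size(1)[of i] \<open>m \<ge> 1\<close> by linarith
    then have "{v\<in>{..<n}. \<pi> v = i} \<noteq> {}" by (metis card.empty)
    then show "i \<in> \<pi> ` {..<n}" by blast
  qed
  have bad: "measure_pmf.prob (erdos_renyi n p) {E. \<not> cut_connected (W i j) (H i j) E}
      \<le> (1 + x) ^ n - 1" for i j
  proof -
    have "measure_pmf.prob (erdos_renyi n p) {E. \<not> cut_connected (W i j) (H i j) E}
        \<le> (1 + x) ^ card (W i j) - 1"
      unfolding x_def
    proof (rule prob_not_cut_connected[OF _ p])
      fix S assume "S \<subseteq> W i j" "2 * card S \<le> card (W i j)"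
      then show "(real m - 1) / 2 * real (card S)
          \<le> real (card {(u, v). u \<in> S \<and> v \<in> W i j - S \<and> H i j u v})"
        unfolding W_def H_def by (intro card_crossing_pairs_ge size) auto
    qed (auto simp: W_def H_def)
    also have "card (W i j) \<le> card {..<n}" by (intro card_mono) (auto simp: W_def)
    then have "(1 + x) ^ card (W i j) \<le> (1 + x) ^ n"
      by (intro power_increasing) (auto simp: x_def)
    finally show ?thesis by simp
  qed
  have "{E. \<not> rigid_partition {..<n} \<pi> E}
      \<subseteq> (\<Union>(i, j)\<in>UNIV. {E. \<not> cut_connected (W i j) (H i j) E})"
    using surj by (auto simp: rigid_partition_def W_def H_def)
  then have "measure_pmf.prob (erdos_renyi n p) {E. \<not> rigid_partition {..<n} \<pi> E}
      \<le> measure_pmf.prob (erdos_renyi n p)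
          (\<Union>(i, j)\<in>UNIV. {E. \<not> cut_connected (W i j) (H i j) E})"
    by (intro measure_pmf.finite_measure_mono) auto
  also have "\<dots> \<le> (\<Sum>(i, j)\<in>UNIV.
      measure_pmf.prob (erdos_renyi n p) {E. \<not> cut_connected (W i j) (H i j) E})"
    unfolding case_prod_unfold
    by (intro measure_pmf.finite_measure_subadditive_finite) auto
  also have "\<dots> \<le> (\<Sum>(i :: 'd, j :: 'd)\<in>UNIV. (1 + x) ^ n - 1)"
    unfolding case_prod_unfold by (intro sum_mono bad)
  also have "\<dots> = (real CARD('d))\<^sup>2 * ((1 + x) ^ n - 1)"
    by (simp add: case_prod_unfold power2_eq_square)
  also have "{E. \<not> rigid_partition {..<n} \<pi> E} = UNIV - {E. rigid_partition {..<n} \<pi> E}" by auto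
  finally have "1 - measure_pmf.prob (erdos_renyi n p) {E. rigid_partition {..<n} \<pi> E}
      \<le> (real CARD('d))\<^sup>2 * ((1 + x) ^ n - 1)"
    using measure_pmf.prob_compl[of "{E. rigid_partition {..<n} \<pi> E}" "erdos_renyi n p"] by simp
  then show ?thesis by (intro exI[of _ \<pi>]) (simp add: x_def m_def)
qed

section \<open>Choice of the edge probability\<close>

theorem mainTheorem6:
  shows "\<exists>C > (0::real). \<exists>k :: nat.
    (\<lambda>n. measure_pmf.prob (erdos_renyi n (C * ln (real n) ^ k / real n))
            {E. rigid_graph TYPE('d::finite) {..<n} E}) \<longlonglongrightarrow> 1"
proof -
  define d where "d = CARD('d)"
  have "d \<ge> 1" by (simp add: d_def Suc_le_eq)
  \<comment> \<open>For \<open>n \<ge> 4 * d\<close> the expansion constant is at least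
    \<open>n / (4 * d)\<close>, so the factor \<open>8 * d\<close> makes the exponent at least
    \<open>2 * ln n\<close> and \<open>x\<close> at most \<open>1 / (n * n)\<close>.\<close>
  define p where "p n = 8 * real d * ln (real n) ^ 1 / real n" for n :: nat
  \<comment> \<open>This comes from
    \<open>(1 + x) ^ n \<le> exp (n * x) \<le> exp (1 / n)\<close>.\<close>
  define g where "g n = 1 - (real d)\<^sup>2 * (exp (1 / real n) - 1)" for n :: nat
  have "p \<longlonglongrightarrow> 0" unfolding p_def by real_asymp
  then have "eventually (\<lambda>n. p n < 1) sequentially" by (rule order_tendstoD) simp
  then have lower: "eventually (\<lambda>n. g n \<le> measure_pmf.prob (erdos_renyi n (p n))
      {E. rigid_graph TYPE('d) {..<n} E}) sequentially"
    using eventually_ge_at_top[of "4 * d"]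
  proof eventually_elim
    case (elim n)
    have "n \<ge> 4" "d \<le> n" using elim(2) \<open>d \<ge> 1\<close> by linarith+
    have "p n \<ge> 0" using \<open>n \<ge> 4\<close> by (simp add: p_def)
    define x where "x = exp (- (p n * ((real (n div d) - 1) / 2)))"
    obtain \<pi> :: "nat \<Rightarrow> 'd" where \<pi>:
      "1 - (real d)\<^sup>2 * ((1 + x) ^ n - 1)
        \<le> measure_pmf.prob (erdos_renyi n (p n)) {E. rigid_partition {..<n} \<pi> E}"
      using prob_rigid_partition[where 'd = 'd, of "p n" n] \<open>p n \<ge> 0\<close> elim(1) \<open>d \<le> n\<close>
      unfolding x_def d_def by auto
    have "real n < real (d + n div d * d)"
      unfolding of_nat_less_iff using \<open>d \<ge> 1\<close> by (intro dividend_less_div_times) simp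
    then have "real n / real d - 1 \<le> real (n div d)"
      using \<open>d \<ge> 1\<close> by (simp add: field_simps)
    \<comment> \<open>Here \<open>n \<ge> 4 * d\<close> absorbs two losses of 1: the rounding in
      \<open>n div d\<close> and the 1 subtracted in the expansion constant.\<close>
    moreover have "real n / (2 * real d) \<le> real n / real d - 2"
      using elim(2) \<open>d \<ge> 1\<close> by (simp add: field_simps)
    ultimately have "p n * (real n / (4 * real d)) \<le> p n * ((real (n div d) - 1) / 2)"
      using \<open>p n \<ge> 0\<close> by (intro mult_left_mono) auto
    moreover have "p n * (real n / (4 * real d)) = ln (real n) + ln (real n)"
      using \<open>n \<ge> 4\<close> \<open>d \<ge> 1\<close> by (simp add: p_def field_simps)
    ultimately have "ln (real n) + ln (real n) \<le> p n * ((real (n div d) - 1) / 2)" by linarith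
    then have "x \<le> exp (- (ln (real n) + ln (real n)))"
      unfolding x_def by (simp only: exp_le_cancel_iff neg_le_iff_le)
    also have "\<dots> = 1 / (real n * real n)"
      unfolding exp_minus exp_add using \<open>n \<ge> 4\<close> by (simp add: inverse_eq_divide)
    finally have "real n * x \<le> real n * (1 / (real n * real n))"
      by (rule mult_left_mono) simp
    then have "real n * x \<le> 1 / real n" using \<open>n \<ge> 4\<close> by simp
    have "(1 + x) ^ n \<le> exp x ^ n"
      by (intro power_mono exp_ge_add_one_self) (simp add: x_def)
    also have "\<dots> = exp (real n * x)" by (simp add: exp_of_nat_mult)
    also have "\<dots> \<le> exp (1 / real n)" using \<open>real n * x \<le> 1 / real n\<close> by simp
    finally have "g n \<le> 1 - (real d)\<^sup>2 * ((1 + x) ^ n - 1)"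
      by (simp add: g_def mult_left_mono)
    also have "\<dots> \<le> measure_pmf.prob (erdos_renyi n (p n)) {E. rigid_partition {..<n} \<pi> E}"
      by (rule \<pi>)
    also have "\<dots> \<le> measure_pmf.prob (erdos_renyi n (p n)) {E. rigid_graph TYPE('d) {..<n} E}"
      by (intro measure_pmf.finite_measure_mono)
        (auto intro: rigid_graph_if_rigid_partition[of "{..<n}" \<pi>])
    finally show ?case .
  qed
  have g: "g \<longlonglongrightarrow> 1" unfolding g_def by real_asymp
  have "(\<lambda>n. measure_pmf.prob (erdos_renyi n (p n))
      {E. rigid_graph TYPE('d) {..<n} E}) \<longlonglongrightarrow> 1"
    by (rule tendsto_sandwich[OF lower _ g tendsto_const]) simp
  then show ?thesis
    using \<open>d \<ge> 1\<close> unfolding p_def by (intro exI[of _ "8 * real d"] conjI exI[of _ 1]) auto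
qed

end
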